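(* Let $R$ be a ring and let $M$ be an $AB5^*$ right $R$-module. The following statements are equivalent. (1) $M\in\mathcal B$. (2) $n\text{-}\dim M$ is not a limit ordinal and $M$ has an atomic submodule $A$ with $n\text{-}\dim(M/A)<n\text{-}\dim A$.
   Context: Rings are associative with identity and modules are unital right modules. Ordinals are taken to begin with $-1$; thus $0$ is the successor of $-1$ and neither $-1$ nor $0$ is regarded as a limit ordinal. Noetherian dimension (also called dual Krull dimension) $n\text{-}\dim M$: defined by transfinite recursion. $n\text{-}\dim M=-1$ iff $M=0$. For an ordinal $\alpha\ge 0$, $n\text{-}\dim M=\alpha$ iff $n\text{-}\dim M\not<\alpha$ and for every ascending chain $M_0\subseteq M_1\subseteq M_2\subseteq\cdots$ of submodules of $M$ there is $k$ with $n\text{-}\dim(M_{i+1}/M_i)<\alpha$ for all $i\ge k$. If no such ordinal exists, $M$ does not have Noetherian dimension. Any statement or inequality about $n\text{-}\dim X$ includes the assertion that $X$ has Noetherian dimension. A module $M$ is an $AB5^*$ module if for every submodule $B$ of $M$ and every inverse system (i.e. downward directed family) $\{A_i\}_{i\in I}$ of submodules of $M$, $B+\bigcap_{i\in I}A_i=\bigcap_{i\in I}(B+A_i)$. A module $M$ is $\alpha$-short if for every submodule $N$ of $M$ either $n\text{-}\dim N\le\alpha$ or $n\text{-}\dim(M/N)\le\alpha$, and $\alpha$ is the least ordinal with this property. (It is known that an $\alpha$-short module has Noetherian dimension $\alpha$ or $\alpha+1$.) $\mathcal B_\alpha$ is the class of $\alpha$-short modules $M$ with $n\text{-}\dim M=\alpha+1$,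 and $\mathcal B=\bigcup_\alpha\mathcal B_\alpha$. A module $A$ is $\alpha$-atomic if $A\ne0$, $n\text{-}\dim A=\alpha$ and $n\text{-}\dim N<\alpha$ for every proper submodule $N$ of $A$; $A$ is atomic if it is $\alpha$-atomic for some ordinal $\alpha$. *)

theory Defs
  imports "HOL-Algebra.AbelCoset"
begin

section \<open>Ordinals\<close>

text \<open>
  Ordinals are isomorphism classes of well-orders. The type \<open>'a ordinal\<close> contains the order types
  of all well-orders whose field is a set of elements of type \<open>'a\<close>.
\<close>

lemma ordIso_empty: "({} :: 'a rel, {} :: 'a rel) \<in> ordIso"
  by (rule ordIso_reflexive) (simp add: well_order_on_empty)

lemma ordIso_Well_orders: "(r, s) \<in> ordIso \<Longrightarrow> Well_order r \<and> Well_order s"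
  by (simp add: ordIso_def)

quotient_type 'a ordinal = "'a rel" / partial: "\<lambda>r s :: 'a rel. (r, s) \<in> ordIso"
  by (rule part_equivpI)
     (use ordIso_empty in blast, auto intro!: sympI transpI intro: ordIso_symmetric ordIso_transitive)

instantiation ordinal :: (type) wellorder
begin

lift_definition less_eq_ordinal :: "'a ordinal \<Rightarrow> 'a ordinal \<Rightarrow> bool"
  is "\<lambda>r s. (r, s) \<in> ordLeq"
  by (meson ordIso_ordLeq_trans ordIso_symmetric ordLeq_ordIso_trans)

lift_definition less_ordinal :: "'a ordinal \<Rightarrow> 'a ordinal \<Rightarrow> bool"
  is "\<lambda>r s. (r, s) \<in> ordLess"
  by (meson ordIso_ordLess_trans ordIso_symmetric ordLess_ordIso_trans)

instance
proof
  fix x y z :: "'a ordinal"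
  show "(x < y) = (x \<le> y \<and> \<not> y \<le> x)"
    by transfer (metis ordIso_Well_orders not_ordLess_ordLeq ordLess_imp_ordLeq
        not_ordLeq_iff_ordLess)
  show "x \<le> x"
    by transfer (metis ordIso_Well_orders ordLeq_reflexive)
  show "x \<le> z" if "x \<le> y" "y \<le> z"
    using that by transfer (rule ordLeq_transitive)
  show "x = y" if "x \<le> y" "y \<le> x"
    using that by transfer (simp add: ordIso_iff_ordLeq)
  show "x \<le> y \<or> y \<le> x"
    by transfer (metis ordIso_Well_orders ordLeq_total)
  show "P a" if step: "\<And>x. (\<And>y. y < x \<Longrightarrow> P y) \<Longrightarrow> P x" for P and a :: "'a ordinal"
  proof -
    have "P (abs_ordinal r)" if "(r, r) \<in> ordIso" for r
      using that
    proof (induction r rule: wf_induct_rule[OF wf_ordLess])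
      case (1 r)
      show ?case
      proof (rule step)
        fix y assume y: "y < abs_ordinal r"
        have yy: "y = abs_ordinal (rep_ordinal y)" "(rep_ordinal y, rep_ordinal y) \<in> ordIso"
          by (simp_all only: Quotient3_abs_rep[OF Quotient3_ordinal]
              Quotient3_rep_reflp[OF Quotient3_ordinal])
        have "(rep_ordinal y, r) \<in> ordLess"
          using y yy 1(2) by (metis less_ordinal.abs_eq)
        then show "P y" using 1(1) yy by metis
      qed
    qed
    then show ?thesis
      using Quotient3_abs_rep[OF Quotient3_ordinal, of a]
        Quotient3_rep_reflp[OF Quotient3_ordinal, of a] by metis
  qed
qed

end

text \<open>
  Ordinals begin with \<open>-1\<close>: the least element of a type of ordinals plays the role of \<open>-1\<close>,
  the next one that of \<open>0\<close>, and so on. Only the order is ever used, so that this is merely a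
  relabelling (the order type of \<open>{-1, 0, \<dots>, \<beta>, \<dots>}\<close> with \<open>\<beta> < \<alpha>\<close> stands for \<open>\<alpha>\<close>).
\<close>

definition ord_minus_one :: "'o::wellorder"
  where "ord_minus_one = (LEAST a. True)"

definition is_ord_succ :: "'o::wellorder \<Rightarrow> 'o \<Rightarrow> bool"
  where "is_ord_succ a b \<longleftrightarrow> a < b \<and> (\<forall>c. a < c \<longrightarrow> b \<le> c)"

definition limit_ord :: "'o::wellorder \<Rightarrow> bool"
  where "limit_ord b \<longleftrightarrow> b \<noteq> ord_minus_one \<and> (\<nexists>a. is_ord_succ a b)"

section \<open>Right modules\<close>

text \<open>
  Right modules over a not necessarily commutative ring. As in the library's record of modules
  over commutative rings, the fields \<open>mult\<close> and \<open>one\<close> inherited from \<open>ring\<close> are not used.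
\<close>

record ('r, 'm) rmodule = "'m ring" +
  rsmult :: "['m, 'r] \<Rightarrow> 'm" (infixl \<open>\<odot>\<^sub>r\<index>\<close> 70)

locale right_module = R?: ring R + M?: abelian_group M
  for R :: "('r, 'x) ring_scheme" (structure) and M :: "('r, 'm) rmodule" (structure) +
  assumes rsmult_closed: "\<lbrakk>x \<in> carrier M; a \<in> carrier R\<rbrakk> \<Longrightarrow> x \<odot>\<^sub>r\<^bsub>M\<^esub> a \<in> carrier M"
    and rsmult_add_left: "\<lbrakk>x \<in> carrier M; y \<in> carrier M; a \<in> carrier R\<rbrakk>
      \<Longrightarrow> (x \<oplus>\<^bsub>M\<^esub> y) \<odot>\<^sub>r\<^bsub>M\<^esub> a = x \<odot>\<^sub>r\<^bsub>M\<^esub> a \<oplus>\<^bsub>M\<^esub> y \<odot>\<^sub>r\<^bsub>M\<^esub> a"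
    and rsmult_add_right: "\<lbrakk>x \<in> carrier M; a \<in> carrier R; b \<in> carrier R\<rbrakk>
      \<Longrightarrow> x \<odot>\<^sub>r\<^bsub>M\<^esub> (a \<oplus>\<^bsub>R\<^esub> b) = x \<odot>\<^sub>r\<^bsub>M\<^esub> a \<oplus>\<^bsub>M\<^esub> x \<odot>\<^sub>r\<^bsub>M\<^esub> b"
    and rsmult_assoc: "\<lbrakk>x \<in> carrier M; a \<in> carrier R; b \<in> carrier R\<rbrakk>
      \<Longrightarrow> x \<odot>\<^sub>r\<^bsub>M\<^esub> (a \<otimes>\<^bsub>R\<^esub> b) = (x \<odot>\<^sub>r\<^bsub>M\<^esub> a) \<odot>\<^sub>r\<^bsub>M\<^esub> b"
    and rsmult_one: "x \<in> carrier M \<Longrightarrow> x \<odot>\<^sub>r\<^bsub>M\<^esub> \<one>\<^bsub>R\<^esub> = x"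

definition rsubmodule :: "('r, 'x) ring_scheme \<Rightarrow> 'm set \<Rightarrow> ('r, 'm) rmodule \<Rightarrow> bool"
  where "rsubmodule R N M \<longleftrightarrow>
    additive_subgroup N M \<and> (\<forall>x\<in>N. \<forall>a\<in>carrier R. x \<odot>\<^sub>r\<^bsub>M\<^esub> a \<in> N)"

definition sub_rmod :: "('r, 'm) rmodule \<Rightarrow> 'm set \<Rightarrow> ('r, 'm) rmodule"
  where "sub_rmod M N = M\<lparr>carrier := N\<rparr>"

definition quot_rmod :: "('r, 'm) rmodule \<Rightarrow> 'm set \<Rightarrow> ('r, 'm set) rmodule"
  where "quot_rmod M N =
    \<lparr>carrier = a_rcosets\<^bsub>M\<^esub> N, mult = undefined, one = undefined, zero = N, add = set_add M,
     rsmult = \<lambda>X a. \<Union>x\<in>X. N +>\<^bsub>M\<^esub> (x \<odot>\<^sub>r\<^bsub>M\<^esub> a)\<rparr>"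

definition rmod_iso :: "('r, 'x) ring_scheme \<Rightarrow> ('r, 'm) rmodule \<Rightarrow> ('r, 'n) rmodule \<Rightarrow> bool"
  where "rmod_iso R M N \<longleftrightarrow> (\<exists>h. bij_betw h (carrier M) (carrier N) \<and>
    (\<forall>x\<in>carrier M. \<forall>y\<in>carrier M. h (x \<oplus>\<^bsub>M\<^esub> y) = h x \<oplus>\<^bsub>N\<^esub> h y) \<and>
    (\<forall>x\<in>carrier M. \<forall>a\<in>carrier R. h (x \<odot>\<^sub>r\<^bsub>M\<^esub> a) = h x \<odot>\<^sub>r\<^bsub>N\<^esub> a))"

lemma right_module_sub:
  assumes "right_module R M" "rsubmodule R N M"
  shows "right_module R (sub_rmod M N)"
proof -
  interpret right_module R M by fact
  interpret additive_subgroup N M using assms(2) by (simp add: rsubmodule_def)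
  have "abelian_group (sub_rmod M N)"
  proof (rule abelian_groupI, goal_cases)
    case (6 x) then show ?case
      by (intro bexI[of _ "\<ominus>\<^bsub>M\<^esub> x"]) (auto simp: sub_rmod_def M.l_neg intro: a_inv_closed)
  qed (auto simp: sub_rmod_def M.a_ac)
  then show ?thesis
    using assms(2) a_subset
    by (intro right_module.intro right_module_axioms.intro R.ring_axioms)
      (auto simp: sub_rmod_def rsubmodule_def subset_iff rsmult_add_left rsmult_add_right rsmult_assoc rsmult_one)
qed

lemma right_module_quot:
  assumes "right_module R M" "rsubmodule R N M"
  shows "right_module R (quot_rmod M N)"
proof -
  interpret right_module R M by fact
  interpret additive_subgroup N M using assms(2) by (simp add: rsubmodule_def)
  interpret abelian_subgroup N M
    by (rule abelian_subgroupI3) (rule additive_subgroup_axioms, rule M.abelian_group_axioms)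
  let ?Q = "quot_rmod M N"
  have car: "carrier ?Q = (\<lambda>x. N +>\<^bsub>M\<^esub> x) ` carrier M"
    by (auto simp: quot_rmod_def A_RCOSETS_def')
  have add: "(N +>\<^bsub>M\<^esub> x) \<oplus>\<^bsub>?Q\<^esub> (N +>\<^bsub>M\<^esub> y) = N +>\<^bsub>M\<^esub> (x \<oplus>\<^bsub>M\<^esub> y)" if "x \<in> carrier M" "y \<in> carrier M" for x y
    using that by (simp add: quot_rmod_def a_rcos_sum)
  have sm: "(N +>\<^bsub>M\<^esub> x) \<odot>\<^sub>r\<^bsub>?Q\<^esub> a = N +>\<^bsub>M\<^esub> (x \<odot>\<^sub>r\<^bsub>M\<^esub> a)" if x: "x \<in> carrier M" and a: "a \<in> carrier R" for x a
  proof -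
    have "N +>\<^bsub>M\<^esub> (y \<odot>\<^sub>r\<^bsub>M\<^esub> a) = N +>\<^bsub>M\<^esub> (x \<odot>\<^sub>r\<^bsub>M\<^esub> a)" if y: "y \<in> N +>\<^bsub>M\<^esub> x" for y
    proof -
      obtain n where n: "n \<in> N" "y = n \<oplus>\<^bsub>M\<^esub> x" using y by (auto simp: a_r_coset_def')
      have na: "n \<odot>\<^sub>r\<^bsub>M\<^esub> a \<in> N" using assms(2) n a by (auto simp: rsubmodule_def)
      have "y \<odot>\<^sub>r\<^bsub>M\<^esub> a = n \<odot>\<^sub>r\<^bsub>M\<^esub> a \<oplus>\<^bsub>M\<^esub> x \<odot>\<^sub>r\<^bsub>M\<^esub> a" using n x a by (simp add: rsmult_add_left)
      then have "y \<odot>\<^sub>r\<^bsub>M\<^esub> a \<in> N +>\<^bsub>M\<^esub> (x \<odot>\<^sub>r\<^bsub>M\<^esub> a)" using na by (auto simp: a_r_coset_def')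
      then show ?thesis using a_repr_independence' x a rsmult_closed by metis
    qed
    moreover have "x \<in> N +>\<^bsub>M\<^esub> x" using x by (rule a_rcos_self)
    ultimately have "(\<Union>y\<in>N +>\<^bsub>M\<^esub> x. N +>\<^bsub>M\<^esub> (y \<odot>\<^sub>r\<^bsub>M\<^esub> a)) = N +>\<^bsub>M\<^esub> (x \<odot>\<^sub>r\<^bsub>M\<^esub> a)"
      by blast
    then show ?thesis by (simp only: quot_rmod_def rmodule.simps)
  qed
  have zero: "\<zero>\<^bsub>?Q\<^esub> = N +>\<^bsub>M\<^esub> \<zero>\<^bsub>M\<^esub>" using a_subset by (simp add: quot_rmod_def)
  have zero_in: "\<zero>\<^bsub>?Q\<^esub> \<in> carrier ?Q" unfolding car zero by (rule imageI) simp
  have ag: "abelian_group ?Q"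
  proof (rule abelian_groupI)
    fix X Y assume "X \<in> carrier ?Q" "Y \<in> carrier ?Q"
    then obtain x y where X: "x \<in> carrier M" "X = N +>\<^bsub>M\<^esub> x" and Y: "y \<in> carrier M" "Y = N +>\<^bsub>M\<^esub> y"
      unfolding car by blast
    show "X \<oplus>\<^bsub>?Q\<^esub> Y \<in> carrier ?Q" unfolding X Y add[OF X(1) Y(1)] car using X Y by simp
    show "X \<oplus>\<^bsub>?Q\<^esub> Y = Y \<oplus>\<^bsub>?Q\<^esub> X"
      unfolding X Y add[OF X(1) Y(1)] add[OF Y(1) X(1)] by (simp only: M.a_comm[OF X(1) Y(1)])
    fix Z assume "Z \<in> carrier ?Q"
    then obtain z where Z: "z \<in> carrier M" "Z = N +>\<^bsub>M\<^esub> z"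
      unfolding car by blast
    show "(X \<oplus>\<^bsub>?Q\<^esub> Y) \<oplus>\<^bsub>?Q\<^esub> Z = X \<oplus>\<^bsub>?Q\<^esub> (Y \<oplus>\<^bsub>?Q\<^esub> Z)"
      unfolding X Y Z using X(1) Y(1) Z(1) by (simp only: add M.a_closed M.a_assoc)
  next
    fix X assume "X \<in> carrier ?Q"
    then obtain x where X: "x \<in> carrier M" "X = N +>\<^bsub>M\<^esub> x"
      unfolding car by blast
    show "\<zero>\<^bsub>?Q\<^esub> \<oplus>\<^bsub>?Q\<^esub> X = X"
      unfolding zero X add[OF M.zero_closed X(1)] by (simp only: M.l_zero[OF X(1)])
    have "(N +>\<^bsub>M\<^esub> (\<ominus>\<^bsub>M\<^esub> x)) \<oplus>\<^bsub>?Q\<^esub> X = \<zero>\<^bsub>?Q\<^esub>"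
      unfolding zero X add[OF M.a_inv_closed[OF X(1)] X(1)] by (simp only: M.l_neg[OF X(1)])
    then show "\<exists>Y\<in>carrier ?Q. Y \<oplus>\<^bsub>?Q\<^esub> X = \<zero>\<^bsub>?Q\<^esub>"
      unfolding car using X(1) by blast
  qed (rule zero_in)
  show ?thesis
    by (intro right_module.intro right_module_axioms.intro R.ring_axioms ag)
      (auto simp: car add sm rsmult_closed rsmult_add_left rsmult_add_right rsmult_assoc rsmult_one)
qed

lemma copy_exists:
  fixes Q :: "('r,'n) rmodule" and f :: "'n \<Rightarrow> 'm"
  assumes "right_module R Q" "inj_on f (carrier Q)"
  shows "\<exists>X :: ('r,'m) rmodule. right_module R X \<and> rmod_iso R X Q"
proof -
  interpret right_module R Q by fact
  define g where "g = the_inv_into (carrier Q) f"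
  have gf [simp]: "g (f x) = x" if "x \<in> carrier Q" for x using that assms(2) by (simp add: g_def the_inv_into_f_f)
  define X :: "('r,'m) rmodule" where "X = \<lparr>carrier = f ` carrier Q, mult = undefined, one = undefined,
    zero = f \<zero>\<^bsub>Q\<^esub>, add = \<lambda>x y. f (g x \<oplus>\<^bsub>Q\<^esub> g y), rsmult = \<lambda>x a. f (g x \<odot>\<^sub>r\<^bsub>Q\<^esub> a)\<rparr>"
  have ag: "abelian_group X"
  proof (rule abelian_groupI, goal_cases)
    case (6 x) then obtain y where "y \<in> carrier Q" "x = f y" by (auto simp: X_def)
    then show ?case
      by (intro bexI[of _ "f (\<ominus>\<^bsub>Q\<^esub> y)"]) (auto simp: X_def M.l_neg)
  qed (auto simp: X_def M.a_assoc, auto simp: M.a_comm)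
  have "right_module R X"
    by (intro right_module.intro right_module_axioms.intro R.ring_axioms ag)
      (auto simp: X_def rsmult_closed rsmult_add_left rsmult_add_right rsmult_assoc rsmult_one)
  moreover have "bij_betw g (carrier X) (carrier Q)"
    by (rule bij_betw_byWitness[where f' = f]) (auto simp: X_def)
  then have "rmod_iso R X Q"
    unfolding rmod_iso_def by (intro exI[of _ g]) (auto simp: X_def rsmult_closed)
  ultimately show ?thesis by blast
qed

lemma quot_copy_exists:
  assumes "right_module R M" "rsubmodule R N M"
  shows "\<exists>X :: ('r,'m) rmodule. right_module R X \<and> rmod_iso R X (quot_rmod (M :: ('r,'m) rmodule) N)"
proof (rule copy_exists)
  interpret right_module R M by fact
  interpret additive_subgroup N M using assms(2) by (simp add: rsubmodule_def)
  interpret abelian_subgroup N M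
    by (rule abelian_subgroupI3) (rule additive_subgroup_axioms, rule M.abelian_group_axioms)
  show "right_module R (quot_rmod M N)" by (rule right_module_quot) fact+
  show "inj_on (\<lambda>C. SOME x. x \<in> carrier M \<and> C = N +>\<^bsub>M\<^esub> x) (carrier (quot_rmod M N))"
  proof (rule inj_onI)
    fix C D let ?r = "\<lambda>C. SOME x. x \<in> carrier M \<and> C = N +>\<^bsub>M\<^esub> x"
    assume "C \<in> carrier (quot_rmod M N)" "D \<in> carrier (quot_rmod M N)" and e: "?r C = ?r D"
    then have "\<exists>x. x \<in> carrier M \<and> C = N +>\<^bsub>M\<^esub> x" "\<exists>x. x \<in> carrier M \<and> D = N +>\<^bsub>M\<^esub> x"
      by (auto simp: quot_rmod_def A_RCOSETS_def')
    from this[THEN someI_ex] e show "C = D" by metis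
  qed
qed

definition AB5_star :: "('r, 'x) ring_scheme \<Rightarrow> ('r, 'm) rmodule \<Rightarrow> bool"
  where "AB5_star R M \<longleftrightarrow>
    (\<forall>B F. rsubmodule R B M \<longrightarrow> F \<noteq> {} \<longrightarrow> (\<forall>A\<in>F. rsubmodule R A M) \<longrightarrow>
      (\<forall>A\<in>F. \<forall>A'\<in>F. \<exists>A''\<in>F. A'' \<subseteq> A \<inter> A') \<longrightarrow>
      set_add M B (\<Inter>A\<in>F. A) = (\<Inter>A\<in>F. set_add M B A))"

section \<open>Noetherian dimension\<close>

text \<open>
  The elements of \<open>quot_rmod\<close> are cosets, so the type of the carrier changes when passing to a
  quotient. To be able to recurse at a fixed type, the factor \<open>M\<^sub>i\<^sub>+\<^sub>1/M\<^sub>i\<close> is replaced in the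
  recursion by an isomorphic module \<open>X\<close> whose elements have the type of those of \<open>M\<close>; such an \<open>X\<close>
  always exists (lemma \<open>quot_copy_exists\<close>).
\<close>

function has_ndim :: "('r, 'x) ring_scheme \<Rightarrow> ('r, 'm) rmodule \<Rightarrow> 'o::wellorder \<Rightarrow> bool"
  where "has_ndim R M \<alpha> \<longleftrightarrow>
    (if \<alpha> = ord_minus_one then carrier M = {\<zero>\<^bsub>M\<^esub>}
     else \<not> (\<exists>\<beta>\<in>{..<\<alpha>}. has_ndim R M \<beta>) \<and>
       (\<forall>C :: nat \<Rightarrow> 'm set. (\<forall>i. rsubmodule R (C i) M \<and> C i \<subseteq> C (Suc i)) \<longrightarrow>
         (\<exists>k. \<forall>i\<ge>k. \<exists>X :: ('r, 'm) rmodule.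
           right_module R X \<and> rmod_iso R X (quot_rmod (sub_rmod M (C (Suc i))) (C i)) \<and>
           (\<exists>\<beta>\<in>{..<\<alpha>}. has_ndim R X \<beta>))))"
  by pat_completeness auto
termination
  by (relation "inv_image {(a, b). a < b} (\<lambda>(R, M, \<alpha>). \<alpha>)") (auto intro: wf)

declare has_ndim.simps [simp del]

definition ndim_le :: "('r, 'x) ring_scheme \<Rightarrow> ('r, 'm) rmodule \<Rightarrow> 'o::wellorder \<Rightarrow> bool"
  where "ndim_le R M \<alpha> \<longleftrightarrow> (\<exists>\<beta>\<le>\<alpha>. has_ndim R M \<beta>)"

definition ndim_less :: "('r, 'x) ring_scheme \<Rightarrow> ('r, 'm) rmodule \<Rightarrow> 'o::wellorder \<Rightarrow> bool"
  where "ndim_less R M \<alpha> \<longleftrightarrow> (\<exists>\<beta><\<alpha>. has_ndim R M \<beta>)"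

text \<open>
  A type of ordinals that is large enough for modules \<open>M\<close> with elements of type \<open>'m\<close>. If \<open>n-dim M\<close>
  exists, then every ordinal up to it is \<open>n-dim (L/N)\<close> for some submodules \<open>N \<subseteq> L\<close>
  of \<open>M\<close>, so that \<open>n-dim M\<close> has at most as many predecessors as there are pairs of subsets of
  \<open>M\<close>. The summand \<open>nat\<close> ensures that every ordinal of this type has a successor.
\<close>

type_synonym 'm dim_ord = "('m set + nat) ordinal"

section \<open>Short and atomic modules\<close>

definition all_sub_or_quot_ndim_le ::
    "('r, 'x) ring_scheme \<Rightarrow> ('r, 'm) rmodule \<Rightarrow> 'o::wellorder \<Rightarrow> bool"
  where "all_sub_or_quot_ndim_le R M \<alpha> \<longleftrightarrow>
    (\<forall>N. rsubmodule R N M \<longrightarrow> ndim_le R (sub_rmod M N) \<alpha> \<or> ndim_le R (quot_rmod M N) \<alpha>)"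

definition short_rmod :: "('r, 'x) ring_scheme \<Rightarrow> ('r, 'm) rmodule \<Rightarrow> 'o::wellorder \<Rightarrow> bool"
  where "short_rmod R M \<alpha> \<longleftrightarrow>
    all_sub_or_quot_ndim_le R M \<alpha> \<and> (\<forall>\<beta><\<alpha>. \<not> all_sub_or_quot_ndim_le R M \<beta>)"

definition in_B_ord :: "('r, 'x) ring_scheme \<Rightarrow> ('r, 'm) rmodule \<Rightarrow> 'o::wellorder \<Rightarrow> bool"
  where "in_B_ord R M \<alpha> \<longleftrightarrow> short_rmod R M \<alpha> \<and> (\<exists>\<beta>. is_ord_succ \<alpha> \<beta> \<and> has_ndim R M \<beta>)"

definition in_B :: "('r, 'x) ring_scheme \<Rightarrow> ('r, 'm) rmodule \<Rightarrow> bool"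
  where "in_B R M \<longleftrightarrow> (\<exists>\<alpha> :: 'm dim_ord. in_B_ord R M \<alpha>)"

definition atomic_ord :: "('r, 'x) ring_scheme \<Rightarrow> ('r, 'm) rmodule \<Rightarrow> 'o::wellorder \<Rightarrow> bool"
  where "atomic_ord R A \<alpha> \<longleftrightarrow> carrier A \<noteq> {\<zero>\<^bsub>A\<^esub>} \<and> has_ndim R A \<alpha> \<and>
    (\<forall>N. rsubmodule R N A \<longrightarrow> N \<noteq> carrier A \<longrightarrow> ndim_less R (sub_rmod A N) \<alpha>)"

definition atomic_rmod :: "('r, 'x) ring_scheme \<Rightarrow> ('r, 'm) rmodule \<Rightarrow> bool"
  where "atomic_rmod R A \<longleftrightarrow> (\<exists>\<alpha> :: 'm dim_ord. atomic_ord R A \<alpha>)"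

end

theory Submission
  imports Defs "HOL-Library.Nat_Bijection"
begin

text \<open>
  The Noetherian dimension of a module depends only on the ordered set of its submodules: it is the
  deviation of that set with respect to ascending chains. Submodules and factor modules of
  \<open>M\<close> correspond to intervals of the lattice of submodules of \<open>M\<close>, so once this
  is known (\<open>has_ndim_iff\<close>, \<open>dev_le_quot_rmod\<close>), the theorem is a
  statement about intervals in a modular lattice.

  For the forward direction, let \<open>M\<close> be \<open>\<alpha>\<close>-short of dimension \<open>\<alpha> + 1\<close>, and let
  \<open>F\<close> be the family of all submodules \<open>N\<close> with \<open>n-dim (M/N) \<le> \<alpha>\<close>. If \<open>F\<close> has a least
  element \<open>A\<close>, then \<open>A\<close> is atomic: a proper submodule of \<open>A\<close> is not in \<open>F\<close>, so by shortness its
  dimension is at most \<open>\<alpha>\<close>, while \<open>n-dim A \<le> \<alpha>\<close> would give \<open>n-dim M \<le> \<alpha>\<close>. The family \<open>F\<close> is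
  closed under finite intersections, and the point is that \<open>\<Inter>F\<close> belongs to \<open>F\<close>
  (\<open>dev_le_Inter_directed\<close>). This is where \<open>AB5\<^sup>*\<close> enters. Suppose that an ascending chain \<open>B\<close> above
  \<open>\<Inter>F\<close> has infinitely many factors of dimension at least \<open>\<alpha>\<close>. For a fixed \<open>A \<in> F\<close> almost all
  factors of the chain \<open>B\<^sub>k + A\<close> are smaller than that, so the trace of \<open>A\<close> on some
  large factor \<open>B\<^sub>k\<^sub>+\<^sub>1/B\<^sub>k\<close> is not zero; by \<open>AB5\<^sup>*\<close> part of this trace is
  lost when \<open>A\<close> is replaced by a suitable smaller member of \<open>F\<close>. Iterating this yields an ascending
  chain \<open>u\<close> and a descending chain \<open>v\<close> that cross so independently that the lattice of submodules
  contains a copy of the power set of the natural numbers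
  (\<open>crossing_chains_not_dev_le\<close>). But that power set has no deviation, because an infinite set is a
  disjoint union of infinitely many infinite sets, whereas \<open>M\<close> has a Noetherian dimension.

  The backward direction is elementary. Let \<open>A\<close> be atomic with \<open>n-dim (M/A) < n-dim A\<close>. Then
  \<open>n-dim M = n-dim A\<close>, and this ordinal is a successor \<open>\<alpha> + 1\<close>. A submodule \<open>N\<close> either contains \<open>A\<close>,
  and then \<open>M/N\<close> is a factor of \<open>M/A\<close>, or it meets \<open>A\<close> in a proper submodule of \<open>A\<close>, and then
  \<open>N \<inter> A\<close> and \<open>N/(N \<inter> A) \<cong> (N + A)/A\<close> both have dimension at most \<open>\<alpha>\<close>. No ordinal below \<open>\<alpha>\<close> works,
  because the shortness condition for \<open>\<beta>\<close> bounds the dimension by every ordinal above \<open>\<beta>\<close>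
  (\<open>dev_le_of_short\<close>).
\<close>

section \<open>Deviation of a partially ordered set\<close>

text \<open>
  An upper bound for the deviation with respect to ascending chains. The least ordinal plays the
  role of \<open>-1\<close>: for it, the second rule applies to the empty set only, so the bound holds exactly
  for sets with at most one element. Working with upper bounds rather than with the exact value
  makes monotonicity and transport along embeddings provable by rule induction.
\<close>
inductive dev_le :: "'a::order set \<Rightarrow> 'o::wellorder \<Rightarrow> bool" where
  dev_le_trivial: "(\<And>X Y. X \<in> P \<Longrightarrow> Y \<in> P \<Longrightarrow> X = Y) \<Longrightarrow> dev_le P a"
| dev_le_chains: "(\<And>C :: nat \<Rightarrow> 'a. mono C \<Longrightarrow> range C \<subseteq> P \<Longrightarrow>
      \<exists>k. \<forall>i\<ge>k. \<exists>b<a. dev_le (P \<inter> {C i..C (Suc i)}) b) \<Longrightarrow> dev_le P a"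

lemma dev_le_mono: "dev_le P a \<Longrightarrow> a \<le> b \<Longrightarrow> dev_le P b"
proof (erule dev_le.cases, goal_cases)
  case 1 then show ?case by (auto intro: dev_le_trivial)
next
  case (2 P' a')
  show ?case
  proof (rule dev_le_chains)
    fix C :: "nat \<Rightarrow> 'a" assume "mono C" "range C \<subseteq> P"
    then show "\<exists>k. \<forall>i\<ge>k. \<exists>c<b. dev_le (P \<inter> {C i..C (Suc i)}) c"
      using 2 by (meson order_less_le_trans)
  qed
qed

lemma dev_le_minimal_iff:
  assumes "\<And>b. \<not> b < a"
  shows "dev_le P a \<longleftrightarrow> (\<forall>X\<in>P. \<forall>Y\<in>P. X = Y)"
proof
  assume "dev_le P a"
  then show "\<forall>X\<in>P. \<forall>Y\<in>P. X = Y"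
  proof cases
    case dev_le_chains
    \<comment> \<open>A constant chain at \<open>X\<close> would need an ordinal below \<open>a\<close>.\<close>
    have False if "X \<in> P" for X
      using dev_le_chains[of "\<lambda>_. X"] that assms by (auto simp: mono_def)
    then show ?thesis by blast
  qed blast
qed (auto intro: dev_le_trivial)

lemma dev_le_imp_least: "dev_le P a \<Longrightarrow> \<exists>b\<le>a. dev_le P b \<and> (\<forall>c<b. \<not> dev_le P c)"
  using LeastI[of "dev_le P" a] Least_le[of "dev_le P" a] not_less_Least[of _ "dev_le P"] by blast

text \<open>
  Provided that \<open>a\<close> is not the least ordinal, the chain condition may be used without knowing by
  which rule the bound was derived.
\<close>
lemma dev_leD:
  assumes "dev_le P a" "b < a" "mono C" "range C \<subseteq> P"
  shows "\<exists>k. \<forall>i\<ge>k. \<exists>b<a. dev_le (P \<inter> {C i..C (Suc i)}) b"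
  using assms(1)
proof cases
  case dev_le_trivial
  then have "dev_le (P \<inter> {C i..C (Suc i)}) b" for i
    by (intro dev_le.dev_le_trivial) blast
  then show ?thesis using assms(2) by blast
qed (use assms in blast)

text \<open>
  The embedding only has to be monotone and injective: a chain in \<open>Q\<close> is mapped to a chain in
  \<open>P\<close>, and each interval of \<open>Q\<close> into the corresponding interval of \<open>P\<close>. Subsets, isomorphisms and
  the power set of the natural numbers are all treated through this lemma.
\<close>
lemma dev_le_embedding:
  fixes f :: "'b::order \<Rightarrow> 'a::order"
  assumes "dev_le P a" "f ` Q \<subseteq> P" "inj_on f Q" "mono_on Q f"
  shows "dev_le Q a"
  using assms
proof (induction arbitrary: Q)
  case (dev_le_trivial P a)
  then show ?case by (intro dev_le.dev_le_trivial) (meson image_subset_iff inj_onD)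
next
  case (dev_le_chains P a)
  show ?case
  proof (rule dev_le.dev_le_chains)
    fix C :: "nat \<Rightarrow> 'b" assume C: "mono C" "range C \<subseteq> Q"
    have CQ: "C i \<in> Q" for i using C(2) by auto
    have "mono (\<lambda>i. f (C i))" "range (\<lambda>i. f (C i)) \<subseteq> P"
      using C(1) CQ dev_le_chains.prems by (auto simp: mono_def mono_on_def)
    from dev_le_chains.IH[OF this] obtain k where k: "\<forall>i\<ge>k. \<exists>b<a. dev_le (P \<inter> {f (C i)..f (C (Suc i))}) b \<and>
       (\<forall>Q. f ` Q \<subseteq> P \<inter> {f (C i)..f (C (Suc i))} \<longrightarrow> inj_on f Q \<longrightarrow> mono_on Q f \<longrightarrow> dev_le Q b)"
      by (auto simp del: atLeastAtMost_iff)
    have "f ` (Q \<inter> {C i..C (Suc i)}) \<subseteq> P \<inter> {f (C i)..f (C (Suc i))}" for i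
      using CQ dev_le_chains.prems by (auto simp: mono_on_def image_subset_iff)
    moreover have "inj_on f (Q \<inter> {C i..C (Suc i)})" "mono_on (Q \<inter> {C i..C (Suc i)}) f" for i
      using dev_le_chains.prems by (auto intro: inj_on_subset mono_on_subset)
    ultimately show "\<exists>k. \<forall>i\<ge>k. \<exists>b<a. dev_le (Q \<inter> {C i..C (Suc i)}) b"
      using k by meson
  qed
qed

lemma dev_le_subset: "dev_le P a \<Longrightarrow> Q \<subseteq> P \<Longrightarrow> dev_le Q a"
  by (rule dev_le_embedding[where f = "\<lambda>x. x"]) (auto simp: mono_on_def)

lemma dev_le_subinterval:
  "dev_le (P \<inter> {X..Y}) a \<Longrightarrow> X \<le> X' \<Longrightarrow> Y' \<le> Y \<Longrightarrow> dev_le (P \<inter> {X'..Y'}) a"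
  by (erule dev_le_subset) (auto intro: order_trans)

lemma dev_le_iso:
  assumes "\<And>X. X \<in> P \<Longrightarrow> f X \<in> Q" "\<And>Y. Y \<in> Q \<Longrightarrow> g Y \<in> P"
    and "\<And>X. X \<in> P \<Longrightarrow> g (f X) = X" "\<And>Y. Y \<in> Q \<Longrightarrow> f (g Y) = Y"
    and "mono_on P f" "mono_on Q g"
  shows "dev_le P a \<longleftrightarrow> dev_le Q a"
proof
  show "dev_le Q a" if "dev_le P a"
    using that by (rule dev_le_embedding[where f = g]) (use assms in \<open>auto intro: inj_on_inverseI[of Q f g]\<close>)
  show "dev_le P a" if "dev_le Q a"
    using that by (rule dev_le_embedding[where f = f]) (use assms in \<open>auto intro: inj_on_inverseI[of P g f]\<close>)
qed

text \<open>
  Split the infinite set \<open>B - A\<close> into infinitely many infinite pieces and adjoin them to \<open>A\<close> one after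
  the other. Every factor of the resulting chain is an interval of the same kind, so rule induction
  leads to a contradiction.
\<close>
lemma not_dev_le_infinite_Pow_interval:
  fixes A B :: "nat set"
  assumes "infinite (B - A)" "A \<subseteq> B"
  shows "\<not> dev_le {A..B} a"
proof
  assume "dev_le {A..B} a"
  then show False using assms
  proof (induction "{A..B}" a arbitrary: A B)
    case (dev_le_trivial a)
    then have "A = B" by auto
    with dev_le_trivial show ?case by simp
  next
    case (dev_le_chains a)
    obtain g :: "nat \<Rightarrow> nat" where "inj g" "range g \<subseteq> B - A"
      using dev_le_chains.prems infinite_countable_subset by blast
    then have g: "inj g" "g x \<in> B" "g x \<notin> A" for x by auto
    \<comment> \<open>The pieces are the images under \<open>g\<close> of the rows of the pairing function.\<close>
    define C where "C i = A \<union> g ` {x. fst (prod_decode x) < i}" for i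
    have "mono C" by (auto simp: C_def mono_def)
    moreover have AB: "range C \<subseteq> {A..B}" using g(2) dev_le_chains.prems(2) by (auto simp: C_def)
    ultimately obtain k b where k: "\<And>A' B'. {A..B} \<inter> {C k..C (Suc k)} = {A'..B'} \<Longrightarrow>
         infinite (B' - A') \<Longrightarrow> A' \<subseteq> B' \<Longrightarrow> False"
      using dev_le_chains.hyps[of C] by (metis order_refl)
    have "{A..B} \<inter> {C k..C (Suc k)} = {C k..C (Suc k)}"
    proof -
      have "C k \<in> {A..B}" "C (Suc k) \<in> {A..B}" using AB by blast+
      then show ?thesis by (simp add: Int_absorb1)
    qed
    moreover have "C k \<subseteq> C (Suc k)" by (auto simp: C_def)
    moreover have "infinite (C (Suc k) - C k)"
    proof -
      have "inj (\<lambda>n. g (prod_encode (k, n)))"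
        using g(1) by (intro injI) (drule injD, assumption, simp add: prod_encode_eq)
      then have "infinite (range (\<lambda>n. g (prod_encode (k, n))))" by (simp add: finite_image_iff)
      moreover have "range (\<lambda>n. g (prod_encode (k, n))) \<subseteq> C (Suc k) - C k"
        using g(1,3) by (auto simp: C_def dest: injD)
      ultimately show ?thesis using finite_subset by blast
    qed
    ultimately show ?case using k by blast
  qed
qed

text \<open>
  For an ascending chain there are two possibilities: either some member has a small interval above
  it, and then all later factors are small, or every member has a small interval below it, and then
  all factors are small. Hence an \<open>a\<close>-short module has dimension at most \<open>a + 1\<close>.
\<close>
lemma dev_le_of_short:
  fixes X Y :: "'a::order"
  assumes "a < b"
    and short: "\<And>N. N \<in> P \<inter> {X..Y} \<Longrightarrow> dev_le (P \<inter> {X..N}) a \<or> dev_le (P \<inter> {N..Y}) a"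
  shows "dev_le (P \<inter> {X..Y}) b"
proof (rule dev_le_chains)
  fix C :: "nat \<Rightarrow> 'a" assume C: "mono C" "range C \<subseteq> P \<inter> {X..Y}"
  have CI: "C i \<in> P \<inter> {X..Y}" for i using C(2) by blast
  show "\<exists>k. \<forall>i\<ge>k. \<exists>c<b. dev_le (P \<inter> {X..Y} \<inter> {C i..C (Suc i)}) c"
  proof (cases "\<exists>k. dev_le (P \<inter> {C k..Y}) a")
    case True
    then obtain k where k: "dev_le (P \<inter> {C k..Y}) a" by blast
    have "dev_le (P \<inter> {X..Y} \<inter> {C i..C (Suc i)}) a" if "i \<ge> k" for i
    proof (rule dev_le_subset[OF k])
      have "C k \<le> C i" using C(1) that by (simp add: mono_def)
      then show "P \<inter> {X..Y} \<inter> {C i..C (Suc i)} \<subseteq> P \<inter> {C k..Y}" by (auto intro: order_trans)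
    qed
    then show ?thesis using \<open>a < b\<close> by blast
  next
    case False
    have "dev_le (P \<inter> {X..Y} \<inter> {C i..C (Suc i)}) a" for i
    proof (rule dev_le_subset)
      show "dev_le (P \<inter> {X..C (Suc i)}) a" using short[OF CI] False by blast
    qed auto
    then show ?thesis using \<open>a < b\<close> by blast
  qed
qed

section \<open>Intervals in a modular lattice of sets\<close>

text \<open>
  The order-theoretic properties of the family of submodules of a module, with the sum as join.
  Only one inclusion of the modular law is assumed, as the other one holds in every lattice.
\<close>
locale modular_set_lattice =
  fixes P :: "'a set set" and join :: "'a set \<Rightarrow> 'a set \<Rightarrow> 'a set" (infixl \<open>\<uplus>\<close> 65)
  assumes Inter_closed: "F \<subseteq> P \<Longrightarrow> F \<noteq> {} \<Longrightarrow> \<Inter>F \<in> P"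
    and join_closed [intro, simp]: "X \<in> P \<Longrightarrow> Y \<in> P \<Longrightarrow> X \<uplus> Y \<in> P"
    and join_upper1: "X \<in> P \<Longrightarrow> Y \<in> P \<Longrightarrow> X \<subseteq> X \<uplus> Y"
    and join_upper2: "X \<in> P \<Longrightarrow> Y \<in> P \<Longrightarrow> Y \<subseteq> X \<uplus> Y"
    and join_least: "X \<in> P \<Longrightarrow> Y \<in> P \<Longrightarrow> Z \<in> P \<Longrightarrow> X \<subseteq> Z \<Longrightarrow> Y \<subseteq> Z \<Longrightarrow> X \<uplus> Y \<subseteq> Z"
    and modular: "X \<in> P \<Longrightarrow> Y \<in> P \<Longrightarrow> Z \<in> P \<Longrightarrow> X \<subseteq> Z \<Longrightarrow> (X \<uplus> Y) \<inter> Z \<subseteq> X \<uplus> (Y \<inter> Z)"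
begin

lemma Int_closed [intro, simp]: "X \<in> P \<Longrightarrow> Y \<in> P \<Longrightarrow> X \<inter> Y \<in> P"
  using Inter_closed[of "{X, Y}"] by simp

lemma join_mono:
  assumes "X \<in> P" "Y \<in> P" "X' \<in> P" "Y' \<in> P" "X \<subseteq> X'" "Y \<subseteq> Y'"
  shows "X \<uplus> Y \<subseteq> X' \<uplus> Y'"
  using assms join_upper1[of X' Y'] join_upper2[of X' Y'] by (intro join_least) auto

lemma join_absorb:
  assumes "X \<in> P" "Y \<in> P" "Z \<in> P" "X \<subseteq> Y"
  shows "Y \<uplus> (X \<uplus> Z) = Y \<uplus> Z"
proof
  show "Y \<uplus> (X \<uplus> Z) \<subseteq> Y \<uplus> Z"
    using assms by (intro join_least join_mono join_upper1 join_closed) simp_all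
  show "Y \<uplus> Z \<subseteq> Y \<uplus> (X \<uplus> Z)"
    using assms by (intro join_mono join_upper2 join_closed) simp_all
qed

text \<open>
  The lattice form of the isomorphism \<open>X/(X \<inter> Y) \<cong> (X + Y)/Y\<close>: by modularity, joining with \<open>Y\<close> and
  intersecting with \<open>X\<close> are mutually inverse.
\<close>
lemma diamond_dev_le:
  assumes "X \<in> P" "Y \<in> P"
  shows "dev_le (P \<inter> {X \<inter> Y..X}) a \<longleftrightarrow> dev_le (P \<inter> {Y..X \<uplus> Y}) a"
proof (rule dev_le_iso[where f = "\<lambda>Z. Z \<uplus> Y" and g = "\<lambda>Z. Z \<inter> X"])
  fix Z assume Z: "Z \<in> P \<inter> {X \<inter> Y..X}"
  then show "Z \<uplus> Y \<in> P \<inter> {Y..X \<uplus> Y}" using assms join_mono[of Z Y X Y] join_upper2 by auto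
  have "(Z \<uplus> Y) \<inter> X \<subseteq> Z \<uplus> (Y \<inter> X)" using Z assms by (intro modular) auto
  also have "\<dots> \<subseteq> Z" using Z assms by (intro join_least) auto
  finally show "(Z \<uplus> Y) \<inter> X = Z" using Z assms join_upper1[of Z Y] by auto
next
  fix Z assume Z: "Z \<in> P \<inter> {Y..X \<uplus> Y}"
  then show "Z \<inter> X \<in> P \<inter> {X \<inter> Y..X}" using assms by auto
  have "X \<uplus> Y \<subseteq> Y \<uplus> X" using assms by (intro join_least join_upper1 join_upper2) auto
  then have "Z \<subseteq> (Y \<uplus> X) \<inter> Z" using Z by auto
  also have "\<dots> \<subseteq> Y \<uplus> (X \<inter> Z)" using Z assms by (intro modular) auto
  also have "\<dots> \<subseteq> Z \<inter> X \<uplus> Y"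
    using assms Z join_upper1[of "Z \<inter> X" Y] by (intro join_least join_upper2) (auto simp: Int_commute)
  finally have "Z \<subseteq> Z \<inter> X \<uplus> Y" .
  moreover have "Z \<inter> X \<uplus> Y \<subseteq> Z" using Z assms by (intro join_least) auto
  ultimately show "Z \<inter> X \<uplus> Y = Z" by simp
next
  show "mono_on (P \<inter> {X \<inter> Y..X}) (\<lambda>Z. Z \<uplus> Y)"
    by (intro mono_onI join_mono) (use assms in simp_all)
  show "mono_on (P \<inter> {Y..X \<uplus> Y}) (\<lambda>Z. Z \<inter> X)" by (auto intro: mono_onI)
qed

text \<open>
  The dimension of an extension is the larger one of the dimensions of its two parts. A chain \<open>C\<close> in
  \<open>{X..Z}\<close> induces the chain of the \<open>C i \<inter> Y\<close> below \<open>Y\<close> and the chain of the \<open>C i \<uplus> Y\<close> above \<open>Y\<close>. The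
  factor of \<open>C\<close> at \<open>i\<close> is itself an extension of a factor of the first chain by a factor of the second
  one, so the induction hypothesis applies to it at an ordinal below \<open>a\<close>.
\<close>
lemma dev_le_interval_trans:
  assumes "X \<in> P" "Y \<in> P" "Z \<in> P" "X \<subseteq> Y" "Y \<subseteq> Z"
    and "dev_le (P \<inter> {X..Y}) a" "dev_le (P \<inter> {Y..Z}) a"
  shows "dev_le (P \<inter> {X..Z}) a"
  using assms
proof (induction a arbitrary: X Y Z rule: less_induct)
  case (less a)
  show ?case
  proof (cases "\<exists>b. b < a")
    case False
    then have "X = Y" "Y = Z" using less.prems by (auto simp: dev_le_minimal_iff)
    then show ?thesis using less.prems by simp
  next
    case True
    then obtain b0 where b0: "b0 < a" by blast
    show ?thesis
    proof (rule dev_le_chains)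
      fix C :: "nat \<Rightarrow> 'a set" assume C: "mono C" "range C \<subseteq> P \<inter> {X..Z}"
      have "C i \<in> P \<inter> {X..Z}" for i using C(2) by blast
      then have CP [simp]: "C i \<in> P" and CX: "X \<subseteq> C i" and CZ: "C i \<subseteq> Z" for i by simp_all
      have Csuc: "C i \<subseteq> C (Suc i)" for i using C by (auto simp: mono_def)
      have "mono (\<lambda>i. C i \<inter> Y)" "range (\<lambda>i. C i \<inter> Y) \<subseteq> P \<inter> {X..Y}"
        using C(1) CX less.prems by (simp_all add: image_subset_iff mono_def le_infI1)
      from dev_leD[OF less.prems(6) b0 this] obtain k1 where
        k1: "\<And>i. i \<ge> k1 \<Longrightarrow> \<exists>b<a. dev_le (P \<inter> {X..Y} \<inter> {C i \<inter> Y..C (Suc i) \<inter> Y}) b" by blast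
      have "mono (\<lambda>i. C i \<uplus> Y)" unfolding mono_def
        using C(1) less.prems by (intro allI impI join_mono) (auto simp: mono_def)
      moreover have "range (\<lambda>i. C i \<uplus> Y) \<subseteq> P \<inter> {Y..Z}"
        using CZ less.prems by (simp add: image_subset_iff join_upper2 join_least)
      ultimately obtain k2 where
        k2: "\<And>i. i \<ge> k2 \<Longrightarrow> \<exists>b<a. dev_le (P \<inter> {Y..Z} \<inter> {C i \<uplus> Y..C (Suc i) \<uplus> Y}) b"
        using dev_leD[OF less.prems(7) b0] by blast
      have "\<exists>b<a. dev_le (P \<inter> {X..Z} \<inter> {C i..C (Suc i)}) b" if i: "i \<ge> max k1 k2" for i
      proof -
        let ?D = "C i" and ?E = "C (Suc i)"
        obtain b1 where b1: "b1 < a" "dev_le (P \<inter> {X..Y} \<inter> {?D \<inter> Y..?E \<inter> Y}) b1"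
          using k1 i by (metis max.boundedE)
        obtain b2 where b2: "b2 < a" "dev_le (P \<inter> {Y..Z} \<inter> {?D \<uplus> Y..?E \<uplus> Y}) b2"
          using k2 i by (metis max.boundedE)
        define b where "b = max b1 b2"
        have ba: "b < a" using b1 b2 by (simp add: b_def)
        \<comment> \<open>The intermediate element that separates the contributions of the two chains.\<close>
        define I where "I = ?E \<inter> (?D \<uplus> Y)"
        have IP: "I \<in> P" using less.prems by (simp add: I_def)
        have DI: "?D \<subseteq> I" using Csuc join_upper1 less.prems by (auto simp: I_def)
        have IE: "I \<subseteq> ?E" by (simp add: I_def)
        have eq1: "(?E \<inter> Y) \<uplus> ?D = I"
        proof
          show "?E \<inter> Y \<uplus> ?D \<subseteq> I" using less.prems DI join_upper2[of ?D Y] IP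
            by (intro join_least) (auto simp: I_def)
          have "I \<subseteq> ?D \<uplus> (Y \<inter> ?E)"
            using modular[of ?D Y ?E] Csuc less.prems by (auto simp: I_def)
          also have "\<dots> \<subseteq> ?E \<inter> Y \<uplus> ?D" using less.prems join_upper1[of "?E \<inter> Y" ?D]
            by (intro join_least join_upper2) (auto simp: Int_commute)
          finally show "I \<subseteq> ?E \<inter> Y \<uplus> ?D" .
        qed
        have ED: "(?E \<inter> Y) \<inter> ?D = ?D \<inter> Y" using Csuc[of i] by blast
        have "X \<subseteq> ?D \<inter> Y" using CX less.prems(4) by simp
        then have "{?D \<inter> Y..?E \<inter> Y} \<subseteq> {X..Y}"
          by (simp add: atLeastatMost_subset_iff)
        then have "P \<inter> {?D \<inter> Y..?E \<inter> Y} \<subseteq> P \<inter> {X..Y} \<inter> {?D \<inter> Y..?E \<inter> Y}" by blast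
        then have "dev_le (P \<inter> {?D \<inter> Y..?E \<inter> Y}) b"
          using dev_le_mono[OF dev_le_subset[OF b1(2)]] by (simp add: b_def)
        then have 1: "dev_le (P \<inter> {?D..I}) b"
          using diamond_dev_le[of "?E \<inter> Y" ?D b] less.prems eq1 ED by simp
        have eq2: "?E \<uplus> (?D \<uplus> Y) = ?E \<uplus> Y"
          using less.prems Csuc[of i] by (intro join_absorb) simp_all
        have "{?D \<uplus> Y..?E \<uplus> Y} \<subseteq> {Y..Z}"
          using CZ less.prems(2,3,5) by (simp add: atLeastatMost_subset_iff join_upper2 join_least)
        then have "P \<inter> {?D \<uplus> Y..?E \<uplus> Y} \<subseteq> P \<inter> {Y..Z} \<inter> {?D \<uplus> Y..?E \<uplus> Y}" by blast
        then have "dev_le (P \<inter> {?D \<uplus> Y..?E \<uplus> Y}) b"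
          using dev_le_mono[OF dev_le_subset[OF b2(2)]] by (simp add: b_def)
        then have 2: "dev_le (P \<inter> {I..?E}) b"
          using diamond_dev_le[of ?E "?D \<uplus> Y" b] less.prems eq2 by (simp add: I_def)
        have "dev_le (P \<inter> {?D..?E}) b"
          using less.IH[OF ba _ IP _ DI IE 1 2] by simp
        then show ?thesis using ba by (meson dev_le_subset Int_mono Int_lower1 order_refl)
      qed
      then show "\<exists>k. \<forall>i\<ge>k. \<exists>b<a. dev_le (P \<inter> {X..Z} \<inter> {C i..C (Suc i)}) b" by blast
    qed
  qed
qed

lemma dev_le_interval_Int:
  assumes "X \<in> P" "Y \<in> P" "T \<in> P" "X \<subseteq> T" "Y \<subseteq> T"
    and "dev_le (P \<inter> {X..T}) a" "dev_le (P \<inter> {Y..T}) a"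
  shows "dev_le (P \<inter> {X \<inter> Y..T}) a"
proof (rule dev_le_interval_trans)
  have "X \<uplus> Y \<subseteq> T" using assms by (intro join_least)
  then have "P \<inter> {Y..X \<uplus> Y} \<subseteq> P \<inter> {Y..T}" by (intro Int_mono) auto
  then have "dev_le (P \<inter> {Y..X \<uplus> Y}) a" using assms(7) dev_le_subset by blast
  then show "dev_le (P \<inter> {X \<inter> Y..X}) a" by (simp only: diamond_dev_le[OF assms(1,2)])
  show "X \<inter> Y \<in> P" using assms(1,2) by (rule Int_closed)
qed (fact assms Int_lower1)+

text \<open>
  The element \<open>v j \<inter> u (Suc j)\<close> lies below \<open>u l \<uplus> v (Suc l)\<close> for every \<open>l \<noteq> j\<close>: if \<open>l < j\<close>, because
  \<open>v\<close> decreases, and if \<open>j < l\<close>, because \<open>u\<close> increases. It does not lie below \<open>u j \<uplus> v (Suc j)\<close>.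
  Hence a set \<open>S\<close> of natural numbers can be recovered from the intersection of the elements
  \<open>u j \<uplus> v (Suc j)\<close> with \<open>j \<notin> S\<close>, and the power set of the natural numbers embeds into the interval.
\<close>
lemma crossing_chains_not_dev_le:
  assumes T: "T \<in> P"
    and u: "\<And>j. u j \<in> P" "\<And>j. L \<subseteq> u j" "\<And>j. u j \<subseteq> T" "mono u"
    and v: "\<And>j. v j \<in> P" "\<And>j. v j \<subseteq> T" "antimono v"
    and cross: "\<And>j. \<not> v j \<inter> u (Suc j) \<subseteq> u j \<uplus> v (Suc j)"
  shows "\<not> dev_le (P \<inter> {L..T}) a"
proof
  \<comment> \<open>Inserting \<open>T\<close> makes the intersection meaningful for \<open>S = UNIV\<close>.\<close>
  define f where "f S = \<Inter> (insert T ((\<lambda>j. u j \<uplus> v (Suc j)) ` (- S)))" for S :: "nat set"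
  have sep: "S \<subseteq> S'" if S: "f S \<subseteq> f S'" for S S'
  proof
    fix j assume j: "j \<in> S"
    show "j \<in> S'"
    proof (rule ccontr)
      assume "j \<notin> S'"
      then have "f S' \<subseteq> u j \<uplus> v (Suc j)" by (auto simp: f_def)
      moreover have "v j \<inter> u (Suc j) \<subseteq> f S"
        unfolding f_def
      proof (rule Inter_greatest)
        fix Z assume "Z \<in> insert T ((\<lambda>j. u j \<uplus> v (Suc j)) ` (- S))"
        then consider "Z = T" | l where "l \<notin> S" "Z = u l \<uplus> v (Suc l)" by blast
        then show "v j \<inter> u (Suc j) \<subseteq> Z"
        proof cases
          case 2
          then have "l < j \<or> j < l" using j by (metis nat_neq_iff)
          then show ?thesis
          proof
            assume "l < j"
            then have "v j \<subseteq> v (Suc l)" using v(3) by (simp add: antimono_def)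
            then show ?thesis using 2 join_upper2[OF u(1)[of l] v(1)[of "Suc l"]] by auto
          next
            assume "j < l"
            then have "u (Suc j) \<subseteq> u l" using u(4) by (simp add: mono_def)
            then show ?thesis using 2 join_upper1[OF u(1)[of l] v(1)[of "Suc l"]] by auto
          qed
        qed (use v(2) in auto)
      qed
      ultimately show False using cross[of j] S by blast
    qed
  qed
  have "f ` UNIV \<subseteq> P \<inter> {L..T}"
  proof (safe, goal_cases)
    case (1 _ S) then show ?case unfolding f_def using u v T by (intro Inter_closed) auto
  next
    case (2 _ S)
    have "L \<subseteq> u j \<uplus> v (Suc j)" for j using u(2)[of j] join_upper1[OF u(1) v(1)] by blast
    then have "L \<subseteq> f S" using u(2,3)[of 0] by (auto simp: f_def)
    moreover have "f S \<subseteq> T" by (auto simp: f_def)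
    ultimately show ?case by simp
  qed
  moreover have "inj_on f UNIV" by (intro injI subset_antisym sep) simp_all
  moreover have "mono_on UNIV f" by (auto simp: mono_on_def f_def)
  moreover assume "dev_le (P \<inter> {L..T}) a"
  ultimately have "dev_le (UNIV :: nat set set) a" using dev_le_embedding by blast
  then have "dev_le {{}..UNIV :: nat set} a" by (rule dev_le_subset) simp
  then show False using not_dev_le_infinite_Pow_interval[of UNIV "{}" a] by simp
qed

text \<open>
  If \<open>\<Inter>F\<close> did not satisfy the bound, there would be a chain \<open>B\<close> above it with infinitely many large
  factors, and this chain together with a descending sequence of members of \<open>F\<close> could be thinned
  out to a pair of crossing chains. So some bound \<open>c\<close> for \<open>\<Inter>F\<close>, however large, is enough to obtain
  the bound \<open>a\<close> that holds for the members of \<open>F\<close>.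
\<close>
lemma dev_le_Inter_directed:
  fixes a :: "'o::wellorder"
  assumes T: "T \<in> P" and F: "F \<subseteq> P" "F \<noteq> {}" "\<And>A. A \<in> F \<Longrightarrow> A \<subseteq> T"
    and directed: "\<And>A A'. A \<in> F \<Longrightarrow> A' \<in> F \<Longrightarrow> \<exists>A''\<in>F. A'' \<subseteq> A \<inter> A'"
    and ab5: "\<And>B. B \<in> P \<Longrightarrow> (\<Inter>A\<in>F. B \<uplus> A) \<subseteq> B \<uplus> \<Inter>F"
    and le: "\<And>A. A \<in> F \<Longrightarrow> dev_le (P \<inter> {A..T}) a"
    and dim: "dev_le (P \<inter> {\<Inter>F..T}) (c :: 'o)"
  shows "dev_le (P \<inter> {\<Inter>F..T}) a"
proof (cases "\<exists>b. b < a")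
  case False
  then have AT: "A = T" if "A \<in> F" for A
  proof -
    have "A \<in> P \<inter> {A..T}" "T \<in> P \<inter> {A..T}" using F(1) F(3)[OF that] T that by auto
    moreover have "\<forall>X\<in>P \<inter> {A..T}. \<forall>Y\<in>P \<inter> {A..T}. X = Y"
      using le[OF that] False by (subst (asm) dev_le_minimal_iff) auto
    ultimately show ?thesis by blast
  qed
  then have "\<Inter>F = T" using F by blast
  then show ?thesis using le F(2) AT by auto
next
  case True
  then obtain b0 where b0: "b0 < a" by blast
  let ?L = "\<Inter>F"
  have LP: "?L \<in> P" using F by (intro Inter_closed)
  show ?thesis
  proof (rule dev_le_chains, rule ccontr)
    fix B :: "nat \<Rightarrow> 'a set" assume B: "mono B" "range B \<subseteq> P \<inter> {?L..T}"
    assume "\<not> (\<exists>k. \<forall>i\<ge>k. \<exists>b<a. dev_le (P \<inter> {?L..T} \<inter> {B i..B (Suc i)}) b)"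
    then have bad: "\<exists>k\<ge>n. \<not> (\<exists>b<a. dev_le (P \<inter> {?L..T} \<inter> {B k..B (Suc k)}) b)" for n
      by auto
    have "B i \<in> P \<inter> {?L..T}" for i using B(2) by blast
    then have BP [simp]: "B i \<in> P" and LB: "?L \<subseteq> B i" and BT: "B i \<subseteq> T" for i by simp_all
    \<comment> \<open>One step of the construction: given \<open>A\<close> and \<open>n\<close>, choose \<open>k \<ge> n\<close> such that the factor of \<open>B\<close> at
       \<open>k\<close> is large, whereas the factor of \<open>B \<uplus> A\<close> at \<open>k\<close> is small. If no member \<open>A' \<subseteq> A\<close> of \<open>F\<close> could
       serve for \<open>n' = Suc k\<close>, then by \<open>ab5\<close> the element \<open>A \<inter> B (Suc k)\<close> would lie below \<open>B k\<close>, and the two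
       factors would have the same dimension.\<close>
    have step: "\<exists>n' A'. A' \<in> F \<and> n \<le> n' \<and> A' \<subseteq> A \<and> \<not> A \<inter> B n' \<subseteq> B n \<uplus> A'" if A: "A \<in> F" for n A
    proof -
      have AP [simp]: "A \<in> P" using A F by auto
      have "mono (\<lambda>k. B k \<uplus> A)" unfolding mono_def
        using B(1) by (intro allI impI join_mono) (auto simp: mono_def)
      moreover have "range (\<lambda>k. B k \<uplus> A) \<subseteq> P \<inter> {A..T}"
        using BT F(3)[OF A] T by (simp add: image_subset_iff join_upper2 join_least)
      ultimately obtain k0 where
        k0: "\<And>k. k \<ge> k0 \<Longrightarrow> \<exists>b<a. dev_le (P \<inter> {A..T} \<inter> {B k \<uplus> A..B (Suc k) \<uplus> A}) b"
        using dev_leD[OF le[OF A] b0] by blast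
      obtain k where k: "k \<ge> max n k0" "\<not> (\<exists>b<a. dev_le (P \<inter> {?L..T} \<inter> {B k..B (Suc k)}) b)"
        using bad by blast
      obtain b where b: "b < a" "dev_le (P \<inter> {A..T} \<inter> {B k \<uplus> A..B (Suc k) \<uplus> A}) b"
        using k0[of k] k by auto
      have Bk: "B n \<subseteq> B k" "B k \<subseteq> B (Suc k)" using B(1) k by (auto simp: mono_def)
      have "{B k \<uplus> A..B (Suc k) \<uplus> A} \<subseteq> {A..T}"
        using BT F(3)[OF A] T by (simp add: atLeastatMost_subset_iff join_upper2 join_least)
      then have "P \<inter> {B k \<uplus> A..B (Suc k) \<uplus> A} \<subseteq> P \<inter> {A..T} \<inter> {B k \<uplus> A..B (Suc k) \<uplus> A}"
        by blast
      then have "dev_le (P \<inter> {B k \<uplus> A..B (Suc k) \<uplus> A}) b" using b(2) dev_le_subset by blast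
      moreover have "B (Suc k) \<uplus> A = B (Suc k) \<uplus> (B k \<uplus> A)"
        using Bk by (intro join_absorb[symmetric]) simp_all
      ultimately have *: "dev_le (P \<inter> {B (Suc k) \<inter> (B k \<uplus> A)..B (Suc k)}) b"
        using diamond_dev_le[of "B (Suc k)" "B k \<uplus> A" b] by simp
      have "\<exists>A'\<in>F. A' \<subseteq> A \<and> \<not> A \<inter> B (Suc k) \<subseteq> B k \<uplus> A'"
      proof (rule ccontr)
        assume neg: "\<not> ?thesis"
        have "A \<inter> B (Suc k) \<subseteq> B k \<uplus> A'" if A': "A' \<in> F" for A'
        proof -
          obtain A'' where A'': "A'' \<in> F" "A'' \<subseteq> A \<inter> A'" using directed A A' by blast
          then have "A \<inter> B (Suc k) \<subseteq> B k \<uplus> A''" using neg by blast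
          also have "\<dots> \<subseteq> B k \<uplus> A'" using A'' A' F by (intro join_mono) auto
          finally show ?thesis .
        qed
        then have "A \<inter> B (Suc k) \<subseteq> B k \<uplus> ?L" by (intro order_trans[OF INT_greatest ab5]) simp_all
        also have "\<dots> \<subseteq> B k" using LB LP by (intro join_least) auto
        finally have "B k \<uplus> (A \<inter> B (Suc k)) \<subseteq> B k" by (intro join_least) auto
        then have "B (Suc k) \<inter> (B k \<uplus> A) \<subseteq> B k" using modular[of "B k" A "B (Suc k)"] Bk by auto
        then have "{B k..B (Suc k)} \<subseteq> {B (Suc k) \<inter> (B k \<uplus> A)..B (Suc k)}" by simp
        then have "P \<inter> {?L..T} \<inter> {B k..B (Suc k)} \<subseteq> P \<inter> {B (Suc k) \<inter> (B k \<uplus> A)..B (Suc k)}"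
          by blast
        then show False using dev_le_subset[OF *] k(2) b(1) by blast
      qed
      then obtain A' where A': "A' \<in> F" "A' \<subseteq> A" "\<not> A \<inter> B (Suc k) \<subseteq> B k \<uplus> A'" by blast
      have "B n \<uplus> A' \<subseteq> B k \<uplus> A'" using A' F Bk by (intro join_mono) auto
      then show ?thesis using A' k(1) by (intro exI[of _ "Suc k"] exI[of _ A']) auto
    qed
    have "\<exists>h. \<forall>j. snd (h j) \<in> F \<and> (fst (h j) \<le> fst (h (Suc j)) \<and> snd (h (Suc j)) \<subseteq> snd (h j) \<and>
        \<not> snd (h j) \<inter> B (fst (h (Suc j))) \<subseteq> B (fst (h j)) \<uplus> snd (h (Suc j)))"
    proof (rule dependent_nat_choice, goal_cases)
      case 1 then show ?case using F(2) by auto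
    next
      case (2 x n) then show ?case using step[of "snd x" "fst x"] by auto
    qed
    then obtain h where h: "\<And>j. snd (h j) \<in> F" "\<And>j. fst (h j) \<le> fst (h (Suc j))"
      "\<And>j. snd (h (Suc j)) \<subseteq> snd (h j)"
      "\<And>j. \<not> snd (h j) \<inter> B (fst (h (Suc j))) \<subseteq> B (fst (h j)) \<uplus> snd (h (Suc j))" by blast
    have "\<not> dev_le (P \<inter> {?L..T}) c"
    proof (rule crossing_chains_not_dev_le[where u = "\<lambda>j. B (fst (h j))" and v = "\<lambda>j. snd (h j)"])
      show "mono (\<lambda>j. B (fst (h j)))"
        unfolding mono_iff_le_Suc using h(2) monoD[OF B(1)] by blast
      show "antimono (\<lambda>j. snd (h j))" using h(3) by (simp add: antimono_iff_le_Suc)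
      show "snd (h j) \<in> P" "snd (h j) \<subseteq> T" for j
        using h(1)[of j] F(1,3) by blast+
    qed (fact T BP LB BT h(4))+
    then show False using dim by simp
  qed
qed

end

section \<open>Noetherian dimension as a deviation\<close>

abbreviation submods :: "('r, 'x) ring_scheme \<Rightarrow> ('r, 'm) rmodule \<Rightarrow> 'm set set"
  where "submods R M \<equiv> {N. rsubmodule R N M}"

context right_module
begin

lemma rsmult_zero_right: "x \<in> carrier M \<Longrightarrow> x \<odot>\<^sub>r\<^bsub>M\<^esub> \<zero>\<^bsub>R\<^esub> = \<zero>\<^bsub>M\<^esub>"
  using rsmult_add_right[of x "\<zero>\<^bsub>R\<^esub>" "\<zero>\<^bsub>R\<^esub>"] rsmult_closed[of x "\<zero>\<^bsub>R\<^esub>"]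
  by (metis M.add.r_cancel_one' R.l_zero R.zero_closed)

text \<open>
  Negatives are scalar multiples. Hence closure under negation follows from the other closure
  properties, and it need not be checked when a set is shown to be a submodule.
\<close>
lemma rsmult_minus_one: "x \<in> carrier M \<Longrightarrow> x \<odot>\<^sub>r\<^bsub>M\<^esub> (\<ominus>\<^bsub>R\<^esub> \<one>\<^bsub>R\<^esub>) = \<ominus>\<^bsub>M\<^esub> x"
  using rsmult_add_right[of x "\<ominus>\<^bsub>R\<^esub> \<one>\<^bsub>R\<^esub>" "\<one>\<^bsub>R\<^esub>"] rsmult_closed[of x "\<ominus>\<^bsub>R\<^esub> \<one>\<^bsub>R\<^esub>"]
  by (simp add: R.l_neg rsmult_zero_right rsmult_one M.minus_equality)

lemma rsubmodule_iff:
  "rsubmodule R N M \<longleftrightarrow> N \<subseteq> carrier M \<and> \<zero>\<^bsub>M\<^esub> \<in> N \<and> (\<forall>x\<in>N. \<forall>y\<in>N. x \<oplus>\<^bsub>M\<^esub> y \<in> N) \<and>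
    (\<forall>x\<in>N. \<forall>a\<in>carrier R. x \<odot>\<^sub>r\<^bsub>M\<^esub> a \<in> N)" (is "_ \<longleftrightarrow> ?rhs")
proof
  assume "rsubmodule R N M"
  then have "additive_subgroup N M" "\<forall>x\<in>N. \<forall>a\<in>carrier R. x \<odot>\<^sub>r\<^bsub>M\<^esub> a \<in> N"
    by (simp_all add: rsubmodule_def)
  then show ?rhs
    using additive_subgroup.a_subset additive_subgroup.zero_closed additive_subgroup.a_closed
    by metis
next
  assume rhs: ?rhs
  have "\<ominus>\<^bsub>M\<^esub> x \<in> N" if "x \<in> N" for x
    using rhs that rsmult_minus_one[of x] by (metis R.add.inv_closed R.one_closed subsetD)
  then have "subgroup N (add_monoid M)"
    using rhs by (intro M.add.subgroupI) (auto simp: a_inv_def)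
  then show "rsubmodule R N M" using rhs by (simp add: rsubmodule_def additive_subgroup_def)
qed

lemma submods_sub_rmod:
  assumes "rsubmodule R N M"
  shows "submods R (sub_rmod M N) = submods R M \<inter> {{\<zero>\<^bsub>M\<^esub>}..N}"
proof -
  interpret N: right_module R "sub_rmod M N"
    using right_module_sub[OF right_module_axioms assms] .
  show ?thesis
    using assms unfolding N.rsubmodule_iff rsubmodule_iff by (auto simp: sub_rmod_def)
qed

lemma submods_interval: "submods R M \<inter> {{\<zero>\<^bsub>M\<^esub>}..carrier M} = submods R M"
  by (auto simp: rsubmodule_iff)

lemma rsubmodule_carrier: "rsubmodule R (carrier M) M"
  by (auto simp: rsubmodule_iff rsmult_closed)

lemma rsubmodule_zero: "rsubmodule R {\<zero>\<^bsub>M\<^esub>} M"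
proof -
  have "\<zero>\<^bsub>M\<^esub> \<odot>\<^sub>r\<^bsub>M\<^esub> a = \<zero>\<^bsub>M\<^esub>" if "a \<in> carrier R" for a
    using rsmult_add_left[of "\<zero>\<^bsub>M\<^esub>" "\<zero>\<^bsub>M\<^esub>" a] rsmult_closed[of "\<zero>\<^bsub>M\<^esub>" a] that
    by (metis M.add.r_cancel_one' M.l_zero M.zero_closed)
  then show ?thesis by (auto simp: rsubmodule_iff)
qed

lemma mem_set_add_iff: "z \<in> A <+>\<^bsub>M\<^esub> B \<longleftrightarrow> (\<exists>x\<in>A. \<exists>y\<in>B. z = x \<oplus>\<^bsub>M\<^esub> y)"
  by (auto simp: set_add_def')

sublocale submods: modular_set_lattice "submods R M" "set_add M"
proof
  fix F assume "F \<subseteq> submods R M" "F \<noteq> {}"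
  then show "\<Inter>F \<in> submods R M" unfolding rsubmodule_iff by blast
next
  fix X Y assume XY: "X \<in> submods R M" "Y \<in> submods R M"
  then have X: "X \<subseteq> carrier M" "\<zero>\<^bsub>M\<^esub> \<in> X" and Y: "Y \<subseteq> carrier M" "\<zero>\<^bsub>M\<^esub> \<in> Y"
    by (simp_all add: rsubmodule_iff)
  show "X \<subseteq> X <+>\<^bsub>M\<^esub> Y" using X Y by (force simp: mem_set_add_iff)
  show "Y \<subseteq> X <+>\<^bsub>M\<^esub> Y" using X Y by (force simp: mem_set_add_iff)
  have "\<zero>\<^bsub>M\<^esub> \<in> X <+>\<^bsub>M\<^esub> Y" using \<open>X \<subseteq> X <+>\<^bsub>M\<^esub> Y\<close> X by blast
  moreover have "X <+>\<^bsub>M\<^esub> Y \<subseteq> carrier M" using X Y by (auto simp: mem_set_add_iff subset_iff)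
  moreover have "u \<oplus>\<^bsub>M\<^esub> v \<in> X <+>\<^bsub>M\<^esub> Y" if uv: "u \<in> X <+>\<^bsub>M\<^esub> Y" "v \<in> X <+>\<^bsub>M\<^esub> Y" for u v
  proof -
    obtain x y x' y' where *: "x \<in> X" "y \<in> Y" "u = x \<oplus>\<^bsub>M\<^esub> y" "x' \<in> X" "y' \<in> Y" "v = x' \<oplus>\<^bsub>M\<^esub> y'"
      using uv unfolding mem_set_add_iff by blast
    then have c: "x \<in> carrier M" "y \<in> carrier M" "x' \<in> carrier M" "y' \<in> carrier M"
      using X Y by blast+
    then have "u \<oplus>\<^bsub>M\<^esub> v = (x \<oplus>\<^bsub>M\<^esub> x') \<oplus>\<^bsub>M\<^esub> (y \<oplus>\<^bsub>M\<^esub> y')" using * by (simp add: M.a_ac)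
    moreover have "x \<oplus>\<^bsub>M\<^esub> x' \<in> X" "y \<oplus>\<^bsub>M\<^esub> y' \<in> Y" using * XY by (simp_all add: rsubmodule_iff)
    ultimately show ?thesis unfolding mem_set_add_iff by blast
  qed
  moreover have "u \<odot>\<^sub>r\<^bsub>M\<^esub> a \<in> X <+>\<^bsub>M\<^esub> Y" if u: "u \<in> X <+>\<^bsub>M\<^esub> Y" and a: "a \<in> carrier R" for u a
  proof -
    obtain x y where *: "x \<in> X" "y \<in> Y" "u = x \<oplus>\<^bsub>M\<^esub> y" using u unfolding mem_set_add_iff by blast
    then have "x \<in> carrier M" "y \<in> carrier M" using X Y by blast+
    then have "u \<odot>\<^sub>r\<^bsub>M\<^esub> a = x \<odot>\<^sub>r\<^bsub>M\<^esub> a \<oplus>\<^bsub>M\<^esub> y \<odot>\<^sub>r\<^bsub>M\<^esub> a" using * a by (simp add: rsmult_add_left)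
    moreover have "x \<odot>\<^sub>r\<^bsub>M\<^esub> a \<in> X" "y \<odot>\<^sub>r\<^bsub>M\<^esub> a \<in> Y" using * a XY by (simp_all add: rsubmodule_iff)
    ultimately show ?thesis unfolding mem_set_add_iff by blast
  qed
  ultimately show "X <+>\<^bsub>M\<^esub> Y \<in> submods R M" by (simp add: rsubmodule_iff)
  fix Z assume Z: "Z \<in> submods R M"
  show "X <+>\<^bsub>M\<^esub> Y \<subseteq> Z" if "X \<subseteq> Z" "Y \<subseteq> Z"
    using that Z by (auto simp: mem_set_add_iff rsubmodule_iff subset_iff)
  show "(X <+>\<^bsub>M\<^esub> Y) \<inter> Z \<subseteq> X <+>\<^bsub>M\<^esub> (Y \<inter> Z)" if "X \<subseteq> Z"
  proof
    fix z assume "z \<in> (X <+>\<^bsub>M\<^esub> Y) \<inter> Z"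
    then obtain x y where *: "x \<in> X" "y \<in> Y" "z = x \<oplus>\<^bsub>M\<^esub> y" "z \<in> Z"
      by (auto simp: mem_set_add_iff)
    then have c: "x \<in> carrier M" "y \<in> carrier M" using X Y by blast+
    have "x \<in> Z" using * that by blast
    then have "\<ominus>\<^bsub>M\<^esub> x \<in> Z"
      using Z rsmult_minus_one[OF c(1)] by (simp add: rsubmodule_iff) (metis R.add.inv_closed R.one_closed)
    then have "\<ominus>\<^bsub>M\<^esub> x \<oplus>\<^bsub>M\<^esub> z \<in> Z" using Z * by (simp add: rsubmodule_iff)
    moreover have "\<ominus>\<^bsub>M\<^esub> x \<oplus>\<^bsub>M\<^esub> z = y" using c * by (simp add: M.r_neg1)
    ultimately show "z \<in> X <+>\<^bsub>M\<^esub> (Y \<inter> Z)" using * unfolding mem_set_add_iff by blast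
  qed
qed

text \<open>
  The correspondence theorem: submodules of \<open>M/N\<close> are the images of the submodules of \<open>M\<close> that
  contain \<open>N\<close>.
\<close>
lemma dev_le_quot_rmod:
  assumes N: "rsubmodule R N M"
  shows "dev_le (submods R (quot_rmod M N)) a \<longleftrightarrow> dev_le (submods R M \<inter> {N..carrier M}) a"
proof -
  interpret Q: right_module R "quot_rmod M N"
    using right_module_quot[OF right_module_axioms N] .
  interpret additive_subgroup N M using N by (simp add: rsubmodule_def)
  interpret abelian_subgroup N M
    by (rule abelian_subgroupI3) (rule additive_subgroup_axioms, rule M.abelian_group_axioms)
  let ?Q = "quot_rmod M N"
  have car: "carrier ?Q = (\<lambda>x. N +>\<^bsub>M\<^esub> x) ` carrier M"
    by (auto simp: quot_rmod_def A_RCOSETS_def')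
  have add: "(N +>\<^bsub>M\<^esub> x) \<oplus>\<^bsub>?Q\<^esub> (N +>\<^bsub>M\<^esub> y) = N +>\<^bsub>M\<^esub> (x \<oplus>\<^bsub>M\<^esub> y)"
    if "x \<in> carrier M" "y \<in> carrier M" for x y
    using that by (simp add: quot_rmod_def a_rcos_sum)
  have zero: "\<zero>\<^bsub>?Q\<^esub> = N +>\<^bsub>M\<^esub> \<zero>\<^bsub>M\<^esub>" using a_subset by (simp add: quot_rmod_def)
  have eqI: "N +>\<^bsub>M\<^esub> y = N +>\<^bsub>M\<^esub> x" if "y \<in> N +>\<^bsub>M\<^esub> x" "x \<in> carrier M" for x y
    using a_repr_independence'[OF that] by simp
  have sm: "(N +>\<^bsub>M\<^esub> x) \<odot>\<^sub>r\<^bsub>?Q\<^esub> a = N +>\<^bsub>M\<^esub> (x \<odot>\<^sub>r\<^bsub>M\<^esub> a)" if x: "x \<in> carrier M" and a: "a \<in> carrier R" for x a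
  proof -
    have "N +>\<^bsub>M\<^esub> (y \<odot>\<^sub>r\<^bsub>M\<^esub> a) = N +>\<^bsub>M\<^esub> (x \<odot>\<^sub>r\<^bsub>M\<^esub> a)" if y: "y \<in> N +>\<^bsub>M\<^esub> x" for y
    proof -
      obtain n where n: "n \<in> N" "y = n \<oplus>\<^bsub>M\<^esub> x" using y by (auto simp: a_r_coset_def')
      have "n \<odot>\<^sub>r\<^bsub>M\<^esub> a \<in> N" using N n a by (simp add: rsubmodule_iff)
      moreover have "y \<odot>\<^sub>r\<^bsub>M\<^esub> a = n \<odot>\<^sub>r\<^bsub>M\<^esub> a \<oplus>\<^bsub>M\<^esub> x \<odot>\<^sub>r\<^bsub>M\<^esub> a" using n x a by (simp add: rsmult_add_left)
      ultimately have "y \<odot>\<^sub>r\<^bsub>M\<^esub> a \<in> N +>\<^bsub>M\<^esub> (x \<odot>\<^sub>r\<^bsub>M\<^esub> a)" by (auto simp: a_r_coset_def')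
      then show ?thesis using eqI x a rsmult_closed by blast
    qed
    moreover have "x \<in> N +>\<^bsub>M\<^esub> x" using x by (rule a_rcos_self)
    ultimately have "(\<Union>y\<in>N +>\<^bsub>M\<^esub> x. N +>\<^bsub>M\<^esub> (y \<odot>\<^sub>r\<^bsub>M\<^esub> a)) = N +>\<^bsub>M\<^esub> (x \<odot>\<^sub>r\<^bsub>M\<^esub> a)"
      by blast
    then show ?thesis by (simp only: quot_rmod_def rmodule.simps)
  qed
  let ?f = "\<lambda>S. {x \<in> carrier M. N +>\<^bsub>M\<^esub> x \<in> S}" and ?g = "\<lambda>K. (\<lambda>x. N +>\<^bsub>M\<^esub> x) ` K"
  show ?thesis
  proof (rule dev_le_iso[where f = ?f and g = ?g])
    fix S assume S: "S \<in> submods R ?Q"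
    have "N +>\<^bsub>M\<^esub> x = N" if "x \<in> N" for x
      using eqI[of x "\<zero>\<^bsub>M\<^esub>"] that a_subset by simp
    moreover have "N \<in> S" using S zero a_subset by (simp add: Q.rsubmodule_iff)
    ultimately have "N \<subseteq> ?f S" using a_subset by auto
    moreover have "rsubmodule R (?f S) M"
      using S by (auto simp: rsubmodule_iff Q.rsubmodule_iff zero rsmult_closed simp flip: add sm)
    ultimately show "?f S \<in> submods R M \<inter> {N..carrier M}" by auto
    have "S \<subseteq> ?g (carrier M)" using S car by (simp add: Q.rsubmodule_iff)
    then show "?g (?f S) = S" by auto
  next
    fix K assume K: "K \<in> submods R M \<inter> {N..carrier M}"
    then have Kc: "K \<subseteq> carrier M" by simp
    have "\<zero>\<^bsub>?Q\<^esub> \<in> ?g K" using K by (simp add: zero rsubmodule_iff)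
    moreover have "X \<oplus>\<^bsub>?Q\<^esub> Y \<in> ?g K" if "X \<in> ?g K" "Y \<in> ?g K" for X Y
    proof -
      from that obtain x y where "x \<in> K" "y \<in> K" "X = N +>\<^bsub>M\<^esub> x" "Y = N +>\<^bsub>M\<^esub> y" by blast
      then show ?thesis using add Kc K by (auto simp: rsubmodule_iff subset_iff)
    qed
    moreover have "X \<odot>\<^sub>r\<^bsub>?Q\<^esub> a \<in> ?g K" if "X \<in> ?g K" "a \<in> carrier R" for X a
    proof -
      from that obtain x where "x \<in> K" "X = N +>\<^bsub>M\<^esub> x" by blast
      then show ?thesis using sm that Kc K by (auto simp: rsubmodule_iff subset_iff)
    qed
    ultimately show "?g K \<in> submods R ?Q" using car Kc by (simp add: Q.rsubmodule_iff image_mono)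
    have "x \<in> K" if x: "x \<in> carrier M" "y \<in> K" "N +>\<^bsub>M\<^esub> x = N +>\<^bsub>M\<^esub> y" for x y
    proof -
      have "x \<in> N +>\<^bsub>M\<^esub> y" using a_rcos_self[OF x(1)] x(3) by simp
      then obtain n where "n \<in> N" "x = n \<oplus>\<^bsub>M\<^esub> y" by (auto simp: a_r_coset_def')
      then show ?thesis using K x by (auto simp: rsubmodule_iff)
    qed
    then show "?f (?g K) = K" using Kc by auto
  qed (auto simp: mono_on_def)
qed

lemma dev_le_subquotient:
  assumes A: "rsubmodule R A M" and B: "rsubmodule R B M" and "A \<subseteq> B"
  shows "dev_le (submods R (quot_rmod (sub_rmod M B) A)) a \<longleftrightarrow> dev_le (submods R M \<inter> {A..B}) a"
proof -
  interpret B: right_module R "sub_rmod M B"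
    using right_module_sub[OF right_module_axioms B] .
  have "{\<zero>\<^bsub>M\<^esub>} \<subseteq> A" using A by (simp add: rsubmodule_iff)
  then have "A \<in> submods R (sub_rmod M B)"
    unfolding submods_sub_rmod[OF B] using A \<open>A \<subseteq> B\<close> by simp
  then have "dev_le (submods R (quot_rmod (sub_rmod M B) A)) a \<longleftrightarrow>
      dev_le (submods R (sub_rmod M B) \<inter> {A..B}) a"
    using B.dev_le_quot_rmod by (simp add: sub_rmod_def)
  also have "submods R (sub_rmod M B) \<inter> {A..B} = submods R M \<inter> {A..B}"
    unfolding submods_sub_rmod[OF B] using \<open>{\<zero>\<^bsub>M\<^esub>} \<subseteq> A\<close> by auto
  finally show ?thesis .
qed

end

lemma dev_le_rmod_iso:
  assumes "right_module R X" "right_module R Y" "rmod_iso R X Y"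
  shows "dev_le (submods R X) a \<longleftrightarrow> dev_le (submods R Y) a"
proof -
  interpret X: right_module R X by fact
  interpret Y: right_module R Y by fact
  obtain h where h: "bij_betw h (carrier X) (carrier Y)"
    and add: "\<And>x y. x \<in> carrier X \<Longrightarrow> y \<in> carrier X \<Longrightarrow> h (x \<oplus>\<^bsub>X\<^esub> y) = h x \<oplus>\<^bsub>Y\<^esub> h y"
    and sm: "\<And>x a. x \<in> carrier X \<Longrightarrow> a \<in> carrier R \<Longrightarrow> h (x \<odot>\<^sub>r\<^bsub>X\<^esub> a) = h x \<odot>\<^sub>r\<^bsub>Y\<^esub> a"
    using assms(3) unfolding rmod_iso_def by blast
  have hc: "h x \<in> carrier Y" if "x \<in> carrier X" for x using h that by (auto simp: bij_betw_def)
  have inj: "inj_on h (carrier X)" and img: "h ` carrier X = carrier Y"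
    using h by (auto simp: bij_betw_def)
  have "h \<zero>\<^bsub>X\<^esub> = h \<zero>\<^bsub>X\<^esub> \<oplus>\<^bsub>Y\<^esub> h \<zero>\<^bsub>X\<^esub>" using add[of "\<zero>\<^bsub>X\<^esub>" "\<zero>\<^bsub>X\<^esub>"] by simp
  then have zero: "h \<zero>\<^bsub>X\<^esub> = \<zero>\<^bsub>Y\<^esub>" using hc[of "\<zero>\<^bsub>X\<^esub>"] by (metis X.M.zero_closed Y.M.add.r_cancel_one')
  let ?g = "\<lambda>T. {x \<in> carrier X. h x \<in> T}"
  show ?thesis
  proof (rule dev_le_iso[where f = "image h" and g = ?g])
    fix S assume S: "S \<in> submods R X"
    then have Sc: "S \<subseteq> carrier X" by (simp add: X.rsubmodule_iff)
    have "\<zero>\<^bsub>Y\<^esub> \<in> h ` S" using S zero by (force simp: X.rsubmodule_iff)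
    moreover have "u \<oplus>\<^bsub>Y\<^esub> v \<in> h ` S" if "u \<in> h ` S" "v \<in> h ` S" for u v
      using that S Sc add by (auto simp: X.rsubmodule_iff subset_iff simp flip: add)
    moreover have "u \<odot>\<^sub>r\<^bsub>Y\<^esub> a \<in> h ` S" if "u \<in> h ` S" "a \<in> carrier R" for u a
      using that S Sc sm by (auto simp: X.rsubmodule_iff subset_iff simp flip: sm)
    ultimately show "h ` S \<in> submods R Y" using Sc img by (simp add: Y.rsubmodule_iff image_mono flip: img)
    show "?g (h ` S) = S" using Sc inj by (auto dest: inj_onD)
  next
    fix T assume T: "T \<in> submods R Y"
    then show "?g T \<in> submods R X"
      by (auto simp: X.rsubmodule_iff Y.rsubmodule_iff zero add sm X.rsmult_closed)
    have "T \<subseteq> h ` carrier X" using T img by (simp add: Y.rsubmodule_iff)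
    then show "h ` ?g T = T" by auto
  qed (auto simp: mono_on_def)
qed

lemma not_less_ord_minus_one: "\<not> b < (ord_minus_one :: 'o::wellorder)"
  unfolding ord_minus_one_def not_less by (rule Least_le) simp

text \<open>
  By induction on the ordinal. The dimension of a factor \<open>M\<^sub>i\<^sub>+\<^sub>1/M\<^sub>i\<close> is defined through an arbitrary
  isomorphic copy with elements in the type of those of \<open>M\<close>; the submodules of every such copy form an
  ordered set isomorphic to the interval from \<open>M\<^sub>i\<close> to \<open>M\<^sub>i\<^sub>+\<^sub>1\<close>, so the choice of the copy does not matter.
\<close>
lemma has_ndim_iff:
  fixes R :: "('r, 'x) ring_scheme" and M :: "('r, 'm) rmodule" and a :: "'o::wellorder"
  assumes "right_module R M"
  shows "has_ndim R M a \<longleftrightarrow> dev_le (submods R M) a \<and> (\<forall>b<a. \<not> dev_le (submods R M) b)"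
  using assms
proof (induction a arbitrary: M rule: less_induct)
  case (less a)
  interpret right_module R M by fact
  have IH: "(\<exists>b<a. has_ndim R X b) \<longleftrightarrow> (\<exists>b<a. dev_le (submods R X) b)"
    if "right_module R X" for X :: "('r, 'm) rmodule"
  proof
    assume "\<exists>b<a. dev_le (submods R X) b"
    then obtain b where b: "b < a" "dev_le (submods R X) b" by blast
    from dev_le_imp_least[OF b(2)]
    obtain l where l: "l \<le> b" "dev_le (submods R X) l \<and> (\<forall>c<l. \<not> dev_le (submods R X) c)"
      by (elim exE conjE) iprover
    have "l < a" using l(1) b(1) by (rule order_le_less_trans)
    moreover have "has_ndim R X l" using less.IH[OF \<open>l < a\<close> that] l(2) by (rule iffD2)
    ultimately show "\<exists>b<a. has_ndim R X b" by blast
  next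
    assume "\<exists>b<a. has_ndim R X b"
    then show "\<exists>b<a. dev_le (submods R X) b" using less.IH[OF _ that] by blast
  qed
  show ?case
  proof (cases "a = ord_minus_one")
    case True
    have "dev_le (submods R M) a \<longleftrightarrow> carrier M = {\<zero>\<^bsub>M\<^esub>}"
    proof -
      have "dev_le (submods R M) a \<longleftrightarrow> (\<forall>X\<in>submods R M. \<forall>Y\<in>submods R M. X = Y)"
        using True not_less_ord_minus_one by (intro dev_le_minimal_iff) simp
      also have "\<dots> \<longleftrightarrow> carrier M = {\<zero>\<^bsub>M\<^esub>}"
      proof
        assume "\<forall>X\<in>submods R M. \<forall>Y\<in>submods R M. X = Y"
        then show "carrier M = {\<zero>\<^bsub>M\<^esub>}" using rsubmodule_carrier rsubmodule_zero by simp
      next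
        assume zero: "carrier M = {\<zero>\<^bsub>M\<^esub>}"
        have "X = {\<zero>\<^bsub>M\<^esub>}" if "X \<in> submods R M" for X
          using that unfolding mem_Collect_eq rsubmodule_iff zero by blast
        then show "\<forall>X\<in>submods R M. \<forall>Y\<in>submods R M. X = Y" by metis
      qed
      finally show ?thesis .
    qed
    then show ?thesis
      using True by (subst has_ndim.simps) (simp add: not_less_ord_minus_one)
  next
    case False
    have "ord_minus_one < a"
      using False not_less_ord_minus_one[of a] by order
    have chain: "(\<exists>X :: ('r, 'm) rmodule. right_module R X \<and>
        rmod_iso R X (quot_rmod (sub_rmod M (C (Suc i))) (C i)) \<and> (\<exists>b\<in>{..<a}. has_ndim R X b)) \<longleftrightarrow>
        (\<exists>b<a. dev_le (submods R M \<inter> {C i..C (Suc i)}) b)"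
      if C: "\<forall>i. rsubmodule R (C i) M \<and> C i \<subseteq> C (Suc i)" for C :: "nat \<Rightarrow> 'm set" and i
    proof -
      let ?S = "sub_rmod M (C (Suc i))"
      have S: "right_module R ?S" using right_module_sub C less.prems by blast
      have "C i \<in> submods R ?S"
        using C submods_sub_rmod[of "C (Suc i)"] by (simp add: rsubmodule_iff)
      then have Ci: "rsubmodule R (C i) ?S" by simp
      have Q: "right_module R (quot_rmod ?S (C i))" using right_module_quot[OF S Ci] .
      obtain X0 :: "('r, 'm) rmodule" where X0: "right_module R X0" "rmod_iso R X0 (quot_rmod ?S (C i))"
        using quot_copy_exists[OF S Ci] by blast
      have "dev_le (submods R X) b \<longleftrightarrow> dev_le (submods R M \<inter> {C i..C (Suc i)}) b"
        if "right_module R X" "rmod_iso R X (quot_rmod ?S (C i))" for X :: "('r, 'm) rmodule" and b :: 'o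
        unfolding dev_le_rmod_iso[OF that(1) Q that(2)] by (intro dev_le_subquotient) (use C in blast)+
      then show ?thesis using X0 IH unfolding Bex_def lessThan_iff by metis
    qed
    have "has_ndim R M a \<longleftrightarrow> \<not> (\<exists>b<a. has_ndim R M b) \<and>
       (\<forall>C :: nat \<Rightarrow> 'm set. (\<forall>i. rsubmodule R (C i) M \<and> C i \<subseteq> C (Suc i)) \<longrightarrow>
         (\<exists>k. \<forall>i\<ge>k. \<exists>b<a. dev_le (submods R M \<inter> {C i..C (Suc i)}) b))"
      using False chain by (subst has_ndim.simps) (simp cong: imp_cong add: Bex_def)
    also have "(\<forall>C :: nat \<Rightarrow> 'm set. (\<forall>i. rsubmodule R (C i) M \<and> C i \<subseteq> C (Suc i)) \<longrightarrow>
         (\<exists>k. \<forall>i\<ge>k. \<exists>b<a. dev_le (submods R M \<inter> {C i..C (Suc i)}) b)) \<longleftrightarrow> dev_le (submods R M) a"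
      (is "?chains \<longleftrightarrow> _")
    proof
      assume ?chains
      then show "dev_le (submods R M) a"
        by (intro dev_le_chains) (auto simp: mono_iff_le_Suc image_subset_iff)
    next
      assume "dev_le (submods R M) a"
      from dev_leD[OF this \<open>ord_minus_one < a\<close>] show ?chains
        by (auto simp: mono_iff_le_Suc image_subset_iff)
    qed
    finally show ?thesis using IH[OF less.prems] by blast
  qed
qed

lemma ndim_le_iff:
  assumes "right_module R M"
  shows "ndim_le R M a \<longleftrightarrow> dev_le (submods R M) a"
proof
  assume "dev_le (submods R M) a"
  then show "ndim_le R M a"
    unfolding ndim_le_def has_ndim_iff[OF assms] by (rule dev_le_imp_least)
qed (auto simp: ndim_le_def has_ndim_iff[OF assms] intro: dev_le_mono)

lemma ndim_less_iff:
  assumes "right_module R M"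
  shows "ndim_less R M a \<longleftrightarrow> (\<exists>b<a. dev_le (submods R M) b)"
  unfolding ndim_less_def ndim_le_iff[OF assms, symmetric] ndim_le_def by (meson order_le_less_trans order_refl)

section \<open>Short modules and atomic submodules\<close>

theorem theorem3p19:
  fixes R :: "('r, 'x) ring_scheme" and M :: "('r, 'm) rmodule"
  assumes "ring R" and "right_module R M" and "AB5_star R M"
  shows "in_B R M \<longleftrightarrow>
    (\<exists>\<alpha> :: 'm dim_ord. has_ndim R M \<alpha> \<and> \<not> limit_ord \<alpha>) \<and>
    (\<exists>A. rsubmodule R A M \<and> atomic_rmod R (sub_rmod M A) \<and>
      (\<exists>\<gamma> :: 'm dim_ord. has_ndim R (sub_rmod M A) \<gamma> \<and> ndim_less R (quot_rmod M A) \<gamma>))"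
proof -
  interpret right_module R M by fact
  let ?S = "submods R M" and ?O = "{\<zero>\<^bsub>M\<^esub>}" and ?T = "carrier M"
  have S_bounds: "?O \<subseteq> N" "N \<subseteq> ?T" if "N \<in> ?S" for N using that by (auto simp: rsubmodule_iff)
  have OS: "?O \<in> ?S" and TS: "?T \<in> ?S" using rsubmodule_zero rsubmodule_carrier by simp_all
  have sub: "right_module R (sub_rmod M N)"
      "submods R (sub_rmod M N) = ?S \<inter> {?O..N}" if "N \<in> ?S" for N
    using that right_module_sub[OF right_module_axioms] submods_sub_rmod by simp_all
  have ndim_M: "has_ndim R M a \<longleftrightarrow> dev_le (?S \<inter> {?O..?T}) a \<and> (\<forall>b<a. \<not> dev_le (?S \<inter> {?O..?T}) b)"
    for a :: "'m dim_ord"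
    using has_ndim_iff[OF right_module_axioms] by (simp only: submods_interval)
  have ndim_sub: "has_ndim R (sub_rmod M N) a \<longleftrightarrow>
      dev_le (?S \<inter> {?O..N}) a \<and> (\<forall>b<a. \<not> dev_le (?S \<inter> {?O..N}) b)"
    if "N \<in> ?S" for N and a :: "'m dim_ord"
    using has_ndim_iff[OF sub(1)[OF that]] sub(2)[OF that] by simp
  have sub_le: "ndim_le R (sub_rmod M N) a \<longleftrightarrow> dev_le (?S \<inter> {?O..N}) a"
    and sub_less: "ndim_less R (sub_rmod M N) a \<longleftrightarrow> (\<exists>b<a. dev_le (?S \<inter> {?O..N}) b)"
    if "N \<in> ?S" for N and a :: "'m dim_ord"
    using ndim_le_iff[OF sub(1)[OF that]] ndim_less_iff[OF sub(1)[OF that]] sub(2)[OF that] by simp_all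
  have quot_le: "ndim_le R (quot_rmod M N) a \<longleftrightarrow> dev_le (?S \<inter> {N..?T}) a"
    and quot_less: "ndim_less R (quot_rmod M N) a \<longleftrightarrow> (\<exists>b<a. dev_le (?S \<inter> {N..?T}) b)"
    if "N \<in> ?S" for N and a :: "'m dim_ord"
  proof -
    have "right_module R (quot_rmod M N)" using right_module_quot[OF right_module_axioms] that by simp
    then show "ndim_le R (quot_rmod M N) a \<longleftrightarrow> dev_le (?S \<inter> {N..?T}) a"
      "ndim_less R (quot_rmod M N) a \<longleftrightarrow> (\<exists>b<a. dev_le (?S \<inter> {N..?T}) b)"
      using that by (simp_all add: ndim_le_iff ndim_less_iff dev_le_quot_rmod)
  qed
  have short_iff: "all_sub_or_quot_ndim_le R M a \<longleftrightarrow>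
      (\<forall>N\<in>?S. dev_le (?S \<inter> {?O..N}) a \<or> dev_le (?S \<inter> {N..?T}) a)" for a :: "'m dim_ord"
    unfolding all_sub_or_quot_ndim_le_def Ball_def mem_Collect_eq by (simp add: sub_le quot_le)
  have atomic_iff: "atomic_ord R (sub_rmod M A) a \<longleftrightarrow> A \<noteq> ?O \<and> has_ndim R (sub_rmod M A) a \<and>
      (\<forall>N\<in>?S. N \<subset> A \<longrightarrow> (\<exists>b<a. dev_le (?S \<inter> {?O..N}) b))" if A: "A \<in> ?S" for A and a :: "'m dim_ord"
  proof -
    have mem: "rsubmodule R N (sub_rmod M A) \<longleftrightarrow> N \<in> ?S \<and> N \<subseteq> A" for N
      using sub(2)[OF A] S_bounds(1)[of N] by (simp add: set_eq_iff) blast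
    have sub_sub: "sub_rmod (sub_rmod M A) N = sub_rmod M N"
      and car: "carrier (sub_rmod M A) = A" "\<zero>\<^bsub>sub_rmod M A\<^esub> = \<zero>\<^bsub>M\<^esub>" for N
      by (simp_all add: sub_rmod_def)
    have "(\<forall>N. N \<in> ?S \<and> N \<subseteq> A \<longrightarrow> N \<noteq> A \<longrightarrow> ndim_less R (sub_rmod M N) a) \<longleftrightarrow>
        (\<forall>N\<in>?S. N \<subset> A \<longrightarrow> (\<exists>b<a. dev_le (?S \<inter> {?O..N}) b))"
      unfolding Ball_def using sub_less by (intro all_cong1) blast
    then show ?thesis unfolding atomic_ord_def mem sub_sub car by blast
  qed
  show ?thesis
  proof
    assume "in_B R M"
    then obtain \<alpha> \<beta> :: "'m dim_ord" where
      short: "\<And>N. N \<in> ?S \<Longrightarrow> dev_le (?S \<inter> {?O..N}) \<alpha> \<or> dev_le (?S \<inter> {N..?T}) \<alpha>"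
      and succ: "is_ord_succ \<alpha> \<beta>" and M_dim: "has_ndim R M \<beta>"
      unfolding in_B_def in_B_ord_def short_rmod_def short_iff by blast
    have "\<alpha> < \<beta>" and below: "\<And>b. b < \<beta> \<Longrightarrow> b \<le> \<alpha>"
      using succ unfolding is_ord_succ_def by (auto simp: not_less[symmetric])
    have M_le: "dev_le (?S \<inter> {?O..?T}) \<beta>" and M_not_le: "\<not> dev_le (?S \<inter> {?O..?T}) \<alpha>"
      using M_dim \<open>\<alpha> < \<beta>\<close> unfolding ndim_M by blast+
    \<comment> \<open>The atomic submodule is the least one with factor module of dimension at most \<open>\<alpha>\<close>.\<close>
    define F where "F = {N \<in> ?S. dev_le (?S \<inter> {N..?T}) \<alpha>}"
    define A where "A = \<Inter>F"
    have F: "F \<subseteq> ?S" "?T \<in> F"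
      using TS by (auto simp: F_def intro: dev_le_trivial)
    have AS: "A \<in> ?S" using F submods.Inter_closed unfolding A_def by blast
    have directed: "\<exists>A''\<in>F. A'' \<subseteq> A \<inter> A'" if "A \<in> F" "A' \<in> F" for A A'
    proof -
      have "A \<inter> A' \<in> F"
        using that TS submods.dev_le_interval_Int[of A A' ?T \<alpha>] S_bounds(2) submods.Int_closed
        unfolding F_def by blast
      then show ?thesis by blast
    qed
    have "dev_le (?S \<inter> {A..?T}) \<alpha>"
      unfolding A_def
    proof (rule submods.dev_le_Inter_directed[where c = \<beta>])
      show "dev_le (?S \<inter> {\<Inter>F..?T}) \<beta>"
        using M_le by (rule dev_le_subinterval) (use S_bounds[OF AS] in \<open>simp_all add: A_def\<close>)
      show "(\<Inter>A\<in>F. B <+>\<^bsub>M\<^esub> A) \<subseteq> B <+>\<^bsub>M\<^esub> \<Inter>F" if "B \<in> ?S" for B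
      proof -
        have "B <+>\<^bsub>M\<^esub> (\<Inter>A\<in>F. A) = (\<Inter>A\<in>F. B <+>\<^bsub>M\<^esub> A)"
          using \<open>AB5_star R M\<close>[unfolded AB5_star_def, rule_format, of B F] that F directed by blast
        then show ?thesis by simp
      qed
    qed (use F TS directed S_bounds(2) in \<open>auto simp: F_def\<close>)
    then have AF: "A \<in> F" using AS by (simp add: F_def)
    have A_not_le: "\<not> dev_le (?S \<inter> {?O..A}) \<alpha>"
      using submods.dev_le_interval_trans[OF OS AS TS S_bounds[OF AS]] M_not_le AF
      by (auto simp: F_def)
    have "dev_le (?S \<inter> {?O..A}) \<beta>"
      using M_le by (rule dev_le_subinterval) (use S_bounds[OF AS] in simp_all)
    then have A_dim: "has_ndim R (sub_rmod M A) \<beta>"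
      using ndim_sub[OF AS] A_not_le below dev_le_mono by blast
    have "A \<noteq> ?O" using A_not_le by (auto intro: dev_le_trivial)
    moreover have "dev_le (?S \<inter> {?O..N}) \<alpha>" if "N \<in> ?S" "N \<subset> A" for N
    proof -
      have "N \<notin> F" using that(2) A_def by blast
      then show ?thesis using short[OF that(1)] that(1) by (simp add: F_def)
    qed
    ultimately have "atomic_ord R (sub_rmod M A) \<beta>"
      using atomic_iff[OF AS] A_dim \<open>\<alpha> < \<beta>\<close> by blast
    moreover have "ndim_less R (quot_rmod M A) \<beta>"
      using quot_less[OF AS] AF \<open>\<alpha> < \<beta>\<close> by (auto simp: F_def)
    moreover have "\<not> limit_ord \<beta>" using succ by (auto simp: limit_ord_def)
    ultimately show "(\<exists>\<alpha> :: 'm dim_ord. has_ndim R M \<alpha> \<and> \<not> limit_ord \<alpha>) \<and>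
      (\<exists>A. rsubmodule R A M \<and> atomic_rmod R (sub_rmod M A) \<and>
        (\<exists>\<gamma> :: 'm dim_ord. has_ndim R (sub_rmod M A) \<gamma> \<and> ndim_less R (quot_rmod M A) \<gamma>))"
      unfolding atomic_rmod_def using M_dim AS A_dim by blast
  next
    assume "(\<exists>\<alpha> :: 'm dim_ord. has_ndim R M \<alpha> \<and> \<not> limit_ord \<alpha>) \<and>
      (\<exists>A. rsubmodule R A M \<and> atomic_rmod R (sub_rmod M A) \<and>
        (\<exists>\<gamma> :: 'm dim_ord. has_ndim R (sub_rmod M A) \<gamma> \<and> ndim_less R (quot_rmod M A) \<gamma>))"
    then obtain \<delta> \<gamma> \<epsilon> :: "'m dim_ord" and A where M_dim: "has_ndim R M \<delta>" "\<not> limit_ord \<delta>"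
      and AS: "A \<in> ?S" and atomic: "atomic_ord R (sub_rmod M A) \<epsilon>"
      and A_dim: "has_ndim R (sub_rmod M A) \<gamma>" and quot: "ndim_less R (quot_rmod M A) \<gamma>"
      unfolding atomic_rmod_def by blast
    obtain b where b: "b < \<gamma>" "dev_le (?S \<inter> {A..?T}) b" using quot quot_less[OF AS] by blast
    have "\<epsilon> = \<gamma>"
      using atomic_iff[OF AS] atomic A_dim ndim_sub[OF AS] by (metis linorder_neqE)
    have A_le: "dev_le (?S \<inter> {?O..A}) \<gamma>" using A_dim ndim_sub[OF AS] by blast
    have "dev_le (?S \<inter> {?O..?T}) \<gamma>"
      using submods.dev_le_interval_trans[OF OS AS TS S_bounds[OF AS] A_le] b dev_le_mono order_less_imp_le
      by blast
    moreover have M_not_le: "\<not> dev_le (?S \<inter> {?O..?T}) c" if "c < \<gamma>" for c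
    proof
      assume "dev_le (?S \<inter> {?O..?T}) c"
      then have "dev_le (?S \<inter> {?O..A}) c"
        by (rule dev_le_subinterval) (use S_bounds[OF AS] in simp_all)
      then show False using A_dim ndim_sub[OF AS] that by blast
    qed
    ultimately have M_dim': "has_ndim R M \<gamma>" and "\<delta> = \<gamma>"
      using M_dim(1) unfolding ndim_M by (blast, metis linorder_neqE)
    have "\<gamma> \<noteq> ord_minus_one" using b(1) not_less_ord_minus_one by blast
    then obtain \<alpha> where succ: "is_ord_succ \<alpha> \<gamma>"
      using M_dim(2) \<open>\<delta> = \<gamma>\<close> unfolding limit_ord_def by blast
    then have "\<alpha> < \<gamma>" and below: "\<And>c. c < \<gamma> \<Longrightarrow> c \<le> \<alpha>"
      unfolding is_ord_succ_def by (auto simp: not_less[symmetric])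
    have quot_\<alpha>: "dev_le (?S \<inter> {A..?T}) \<alpha>" using b below dev_le_mono by blast
    have "dev_le (?S \<inter> {?O..N}) \<alpha> \<or> dev_le (?S \<inter> {N..?T}) \<alpha>" if N: "N \<in> ?S" for N
    proof (cases "A \<subseteq> N")
      case True
      have "dev_le (?S \<inter> {N..?T}) \<alpha>" 
        using quot_\<alpha> by (rule dev_le_subinterval) (use True in simp_all)
      then show ?thesis by blast
    next
      case False
      have NA: "N \<inter> A \<in> ?S" using N AS by (rule submods.Int_closed)
      moreover have "N \<inter> A \<subset> A" using False by blast
      ultimately have "\<exists>c<\<gamma>. dev_le (?S \<inter> {?O..N \<inter> A}) c"
        using atomic_iff[OF AS] atomic \<open>\<epsilon> = \<gamma>\<close> by blast
      then have 1: "dev_le (?S \<inter> {?O..N \<inter> A}) \<alpha>" using below dev_le_mono by blast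
      have "N <+>\<^bsub>M\<^esub> A \<subseteq> ?T" using S_bounds(2)[OF submods.join_closed[OF N AS]] .
      with quot_\<alpha> order_refl have "dev_le (?S \<inter> {A..N <+>\<^bsub>M\<^esub> A}) \<alpha>"
        by (rule dev_le_subinterval)
      then have 2: "dev_le (?S \<inter> {N \<inter> A..N}) \<alpha>" by (simp only: submods.diamond_dev_le[OF N AS])
      have "dev_le (?S \<inter> {?O..N}) \<alpha>"
        using submods.dev_le_interval_trans[OF OS NA N S_bounds(1)[OF NA] Int_lower1 1 2] .
      then show ?thesis by blast
    qed
    then have "all_sub_or_quot_ndim_le R M \<alpha>" unfolding short_iff by blast
    moreover have "\<not> all_sub_or_quot_ndim_le R M c" if "c < \<alpha>" for c
      using dev_le_of_short[OF that] M_not_le[OF \<open>\<alpha> < \<gamma>\<close>] unfolding short_iff by blast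
    ultimately show "in_B R M"
      unfolding in_B_def in_B_ord_def short_rmod_def using succ M_dim' by blast
  qed
qed

end
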